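(* Let $p$ be a prime number and fix an isomorphism of fields $\mathbb{C}\simeq\overline{\mathbb{Q}}_p$, used to identify the two fields. (i) If $z\in\mathfrak{h}\cap\mathbb{Q}_p\subset\mathbb{C}=\overline{\mathbb{Q}}_p$ is an imaginary quadratic irrational, then its $\{\infty,p\}$-continued fraction expansion is periodic, i.e. there exist $k<l$ such that $x_k=x_l$. (ii) Let $F$ be an imaginary quadratic field $\mathbb{Q}(\sqrt{-d})\subset\mathbb{C}=\overline{\mathbb{Q}}_p$, where $d$ is a positive square free integer. Suppose $F\subset\mathbb{Q}_p$. Let $\theta=\frac{-1+\sqrt{-d}}{2}$ if $-d\equiv1\bmod4$, and $\theta=\sqrt{-d}$ otherwise. Then the $\{\infty,p\}$-continued fraction expansion of $\theta$ is purely periodic, i.e. there is an integer $N\ge1$ with $\theta=x_1=x_{N+1}$, and its period provides a fundamental norm one $p$-unit of $F$, in the following sense: if $N$ is the smallest such integer and $\begin{pmatrix} q_N & r_N \\ s_N & t_N \end{pmatrix}=B_N^{-1}$, then $\epsilon=s_N\theta+t_N$ is a generator of the rank one free abelian group $\mathcal{O}_F[1/p]^1/(\text{torsion})$, where $\mathcal{O}_F[1/p]^1=\{x\in\mathcal{O}_F[1/p]^\times:N_{F/\mathbb{Q}}(x)=1\}$.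
   Context: $\mathfrak{h}=\{z\in\mathbb{C}:\Im z>0\}$; $\sqrt{-d}$ is the root in $\mathfrak{h}$; $\mathcal{O}_F$ is the ring of integers of $F$. $\mathcal{D}=\{z\in\mathfrak{h}:|z|>1,\ -\frac12\le\Re z<\frac12\}\cup\{e^{i\alpha}:\alpha\in[\pi/2,2\pi/3]\}$. Matrices in $SL_2(\mathbb{Z}[1/p])$ act by linear fractional transformations. $\{\infty,p\}$-continued fraction expansion of $z\in\mathfrak{h}\cap\mathbb{Q}_p$. Set $x_1=z$. For $x_k$, $k\ge1$, do the following. Initialization: if $x_k\in\mathbb{Z}_p$, set $z_k=x_k$, $\delta_k=+1$ and $D_k=I$ (identity matrix); otherwise set $z_k=-1/x_k\in\mathbb{Z}_p$, $\delta_k=-1$ and $D_k=\begin{pmatrix} 0 & -1 \\ 1 & 0 \end{pmatrix}$. $p$-adic reduction: determine $a_k\in\{0,\dots,p^2-1\}$ such that $z_k-a_k\equiv0\bmod p^2$ (in $\mathbb{Z}_p$), and set $z_{k0}=(z_k-a_k)/p^2$, $P_k=\begin{pmatrix} 1/p & 0 \\ 0 & p \end{pmatrix}\begin{pmatrix} 1 & -a_k \\ 0 & 1 \end{pmatrix}$. $\infty$-adic reduction: for $j\ge0$, if $z_{kj}\in\mathcal{D}$, set $x_{k+1}=z_{kj}$ and go to the initialization step for $k+1$; if not, determine $b_{kj}\in\mathbb{Z}$ so that $-\frac12\le\Re(z_{kj}-b_{kj})<\frac12$ and set $z_{k,j+1}=-1/(z_{kj}-b_{kj})$. The $\infty$-adic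 reduction is asserted to end within a finite number of steps, so that the algorithm is well defined. If $b_{k0},\dots,b_{kl_k}$ are the integers so obtained, set $Q_k=\begin{pmatrix} 0 & -1 \\ 1 & -b_{kl_k} \end{pmatrix}\cdots\begin{pmatrix} 0 & -1 \\ 1 & -b_{k0} \end{pmatrix}$ (the empty product being $I$). Put $A_k^{-1}=Q_kP_kD_k$ and $B_k=A_1\cdots A_k\in SL_2(\mathbb{Z}[1/p])$, so that $x_{k+1}=A_k^{-1}x_k=B_k^{-1}x_1$. The expansion is written formally as $z=[\delta_1;a_1;b_{10},\dots,b_{1l_1};\delta_2;a_2;b_{20},\dots,b_{2l_2};\dots]$.
   Formalization: For z in Q(√-3) in (i), and for d=3 in (ii), it is assumed that every ∞-adic reduction ends: as described, the reduction loops forever at exp(πi/3), so for d=3 no expansion of θ exists and (ii) is void there. In all other cases termination is proved. *)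

theory Defs
  imports
    "HOL-Analysis.Analysis"
    "HOL-Algebra.Algebraic_Closure_Type"
    "HOL-Algebra.Elementary_Groups"
    "HOL-Computational_Algebra.Fraction_Field"
    "HOL-Computational_Algebra.Squarefree"
    "Berlekamp_Zassenhaus.Finite_Field"
begin

section \<open>The p-adic numbers\<close>

text \<open>
  A prime \<open>p\<close> is given as the cardinality of a type of class \<open>prime_card\<close>.  The ring of p-adic
  integers is the inverse limit of the rings \<open>\<int>/p\<^sup>n\<int>\<close>, a residue class modulo \<open>p\<^sup>n\<close> being
  represented by its least non-negative element; its fraction field is the field of p-adic numbers.
\<close>

typedef (overloaded) 'p padic_int =
  "{f :: nat \<Rightarrow> int. \<forall>n. f n \<in> {0..<int CARD('p::prime_card) ^ n} \<and>
                       f (Suc n) mod int CARD('p) ^ n = f n}"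
  by (rule exI[of _ "\<lambda>_. 0"]) (use prime_gt_0_nat[OF prime_card] in auto)

setup_lifting type_definition_padic_int

lemma padic_mod_coherent:
  fixes F :: "nat \<Rightarrow> int"
  assumes "F (Suc n) mod int CARD('p::prime_card) ^ n = F n mod int CARD('p) ^ n"
  shows "F n mod int CARD('p) ^ n \<in> {0..<int CARD('p) ^ n} \<and>
         F (Suc n) mod int CARD('p) ^ Suc n mod int CARD('p) ^ n = F n mod int CARD('p) ^ n"
proof -
  have "F (Suc n) mod int CARD('p) ^ Suc n mod int CARD('p) ^ n = F (Suc n) mod int CARD('p) ^ n"
    by (rule mod_mod_cancel) simp
  then show ?thesis using assms prime_gt_0_nat[OF prime_card[where 'a = 'p]] by simp
qed

instantiation padic_int :: (prime_card) comm_ring_1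
begin

lift_definition zero_padic_int :: "'a padic_int" is "\<lambda>_. 0"
  using prime_gt_0_nat[OF prime_card] by auto

lift_definition one_padic_int :: "'a padic_int" is "\<lambda>n. 1 mod int CARD('a) ^ n"
  using padic_mod_coherent[where F = "\<lambda>_. 1"] by blast

lift_definition plus_padic_int :: "'a padic_int \<Rightarrow> 'a padic_int \<Rightarrow> 'a padic_int"
  is "\<lambda>f g n. (f n + g n) mod int CARD('a) ^ n"
  subgoal for fun1 fun2 n
    by (rule padic_mod_coherent[where F = "\<lambda>n. fun1 n + fun2 n"]) (metis mod_add_eq)
  done

lift_definition times_padic_int :: "'a padic_int \<Rightarrow> 'a padic_int \<Rightarrow> 'a padic_int"
  is "\<lambda>f g n. (f n * g n) mod int CARD('a) ^ n"
  subgoal for fun1 fun2 n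
    by (rule padic_mod_coherent[where F = "\<lambda>n. fun1 n * fun2 n"]) (metis mod_mult_eq)
  done

lift_definition uminus_padic_int :: "'a padic_int \<Rightarrow> 'a padic_int"
  is "\<lambda>f n. (- f n) mod int CARD('a) ^ n"
  subgoal for fun1 n
    by (rule padic_mod_coherent[where F = "\<lambda>n. - fun1 n"]) (metis mod_minus_eq)
  done

lift_definition minus_padic_int :: "'a padic_int \<Rightarrow> 'a padic_int \<Rightarrow> 'a padic_int"
  is "\<lambda>f g n. (f n - g n) mod int CARD('a) ^ n"
  subgoal for fun1 fun2 n
    by (rule padic_mod_coherent[where F = "\<lambda>n. fun1 n - fun2 n"]) (metis mod_diff_eq)
  done

instance
proof
  fix a b c :: "'a padic_int"
  show "a + b + c = a + (b + c)" by transfer (auto simp: mod_simps algebra_simps)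
  show "a + b = b + a" by transfer (auto simp: algebra_simps)
  show "0 + a = a" by transfer auto
  show "- a + a = 0" by transfer (auto simp: mod_simps)
  show "a - b = a + - b" by transfer (auto simp: mod_simps)
  show "a * b * c = a * (b * c)" by transfer (auto simp: mod_simps algebra_simps)
  show "a * b = b * a" by transfer (auto simp: algebra_simps)
  show "1 * a = a" by transfer (auto simp: mod_simps)
  show "(a + b) * c = a * c + b * c" by transfer (auto simp: mod_simps algebra_simps)
  show "(0 :: 'a padic_int) \<noteq> 1"
  proof (transfer, rule notI)
    assume "(\<lambda>_. 0) = (\<lambda>n. 1 mod int CARD('a) ^ n)"
    then have "0 = 1 mod int CARD('a) ^ 1" by (rule fun_cong)
    then show False using prime_gt_1_nat[OF prime_card[where 'a = 'a]] by simp
  qed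
qed

end

lemma padic_int_mod:
  fixes x :: "'p::prime_card padic_int"
  shows "Rep_padic_int x (n + k) mod int CARD('p) ^ n = Rep_padic_int x n"
proof (induction k)
  case 0
  then show ?case using Rep_padic_int[of x] by auto
next
  case (Suc k)
  have "Rep_padic_int x (n + Suc k) mod int CARD('p) ^ (n + k) = Rep_padic_int x (n + k)"
    using Rep_padic_int[of x] by auto
  moreover have "Rep_padic_int x (n + Suc k) mod int CARD('p) ^ (n + k) mod int CARD('p) ^ n
      = Rep_padic_int x (n + Suc k) mod int CARD('p) ^ n"
    by (rule mod_mod_cancel) (simp add: power_add)
  ultimately show ?case using Suc by simp
qed

lemma padic_int_nonzero:
  fixes x :: "'p::prime_card padic_int"
  assumes "x \<noteq> 0"
  obtains n where "\<And>k. Rep_padic_int x (n + k) mod int CARD('p) ^ n \<noteq> 0"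
proof -
  obtain n where "Rep_padic_int x n \<noteq> 0"
    using assms by (metis Rep_padic_int_inject ext zero_padic_int.rep_eq)
  then show ?thesis using that[of n] padic_int_mod[of x n] by simp
qed

instance padic_int :: (prime_card) idom
proof
  fix a b :: "'a padic_int"
  assume "a \<noteq> 0" "b \<noteq> 0"
  let ?p = "int CARD('a)"
  have p: "Factorial_Ring.prime ?p" using prime_card[where 'a = 'a] by simp
  obtain n where n: "\<And>k. Rep_padic_int a (n + k) mod ?p ^ n \<noteq> 0"
    using padic_int_nonzero[OF \<open>a \<noteq> 0\<close>] by blast
  obtain m where m: "\<And>k. Rep_padic_int b (m + k) mod ?p ^ m \<noteq> 0"
    using padic_int_nonzero[OF \<open>b \<noteq> 0\<close>] by blast
  define A B where "A = Rep_padic_int a (n + m)" and "B = Rep_padic_int b (n + m)"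
  have A: "\<not> ?p ^ n dvd A" using n[of m] by (auto simp: A_def)
  have B: "\<not> ?p ^ m dvd B" using m[of n] by (auto simp: B_def add.commute)
  have "A \<noteq> 0" "B \<noteq> 0" using A B by auto
  then have "multiplicity ?p (A * B) = multiplicity ?p A + multiplicity ?p B"
    using p by (intro prime_elem_multiplicity_mult_distrib) auto
  moreover have "multiplicity ?p A < n" "multiplicity ?p B < m"
    using A B multiplicity_dvd' not_le by blast+
  ultimately have "\<not> ?p ^ (n + m) dvd A * B"
    using \<open>A \<noteq> 0\<close> \<open>B \<noteq> 0\<close> p
    by (metis add_less_mono mult_eq_0_iff not_le not_prime_unit power_dvd_iff_le_multiplicity)
  then have "Rep_padic_int (a * b) (n + m) \<noteq> 0"
    by (simp add: times_padic_int.rep_eq A_def B_def dvd_eq_mod_eq_0)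
  then show "a * b \<noteq> 0" by (auto simp: zero_padic_int.rep_eq)
qed

type_synonym 'p padic = "'p padic_int fract"

text \<open>
  An isomorphism \<open>\<iota>\<close> from the complex numbers to the algebraic closure of the p-adic numbers
  identifies the p-adic numbers and the p-adic integers with the following sets of complex numbers.
\<close>

definition padic_numbers :: "(complex \<Rightarrow> 'p::prime_card padic alg_closure) \<Rightarrow> complex set" where
  "padic_numbers \<iota> = {z. \<iota> z \<in> range to_ac}"

definition padic_integers :: "(complex \<Rightarrow> 'p::prime_card padic alg_closure) \<Rightarrow> complex set" where
  "padic_integers \<iota> = {z. \<exists>u. \<iota> z = to_ac (Fract u 1)}"


section \<open>The continued fraction algorithm\<close>

definition fund_dom :: "complex set" where
  "fund_dom = {z. Im z > 0 \<and> cmod z > 1 \<and> - 1 / 2 \<le> Re z \<and> Re z < 1 / 2}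
              \<union> cis ` {pi / 2..2 * pi / 3}"

definition cf_delta :: "(complex \<Rightarrow> 'p::prime_card padic alg_closure) \<Rightarrow> complex \<Rightarrow> int" where
  "cf_delta \<iota> x = (if x \<in> padic_integers \<iota> then 1 else - 1)"

definition cf_init :: "(complex \<Rightarrow> 'p::prime_card padic alg_closure) \<Rightarrow> complex \<Rightarrow> complex" where
  "cf_init \<iota> x = (if cf_delta \<iota> x = 1 then x else - 1 / x)"

definition cf_D :: "(complex \<Rightarrow> 'p::prime_card padic alg_closure) \<Rightarrow> complex \<Rightarrow> rat^2^2" where
  "cf_D \<iota> x = (if cf_delta \<iota> x = 1 then mat 1 else vector [vector [0, - 1], vector [1, 0]])"

definition cf_a :: "(complex \<Rightarrow> 'p::prime_card padic alg_closure) \<Rightarrow> complex \<Rightarrow> nat" where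
  "cf_a \<iota> x = (THE a. a < CARD('p) ^ 2 \<and>
     (\<exists>u \<in> padic_integers \<iota>. cf_init \<iota> x - of_nat a = of_nat (CARD('p) ^ 2) * u))"

definition cf_z0 :: "(complex \<Rightarrow> 'p::prime_card padic alg_closure) \<Rightarrow> complex \<Rightarrow> complex" where
  "cf_z0 \<iota> x = (cf_init \<iota> x - of_nat (cf_a \<iota> x)) / of_nat (CARD('p) ^ 2)"

definition cf_P :: "(complex \<Rightarrow> 'p::prime_card padic alg_closure) \<Rightarrow> complex \<Rightarrow> rat^2^2" where
  "cf_P \<iota> x = (vector [vector [1 / of_nat CARD('p), 0], vector [0, of_nat CARD('p)]] :: rat^2^2)
              ** vector [vector [1, - of_nat (cf_a \<iota> x)], vector [0, 1]]"

text \<open>\<open>inf_digit z\<close> is the unique integer \<open>b\<close> with \<open>-1/2 \<le> Re (z - b) < 1/2\<close>.\<close>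

definition inf_digit :: "complex \<Rightarrow> int" where
  "inf_digit z = \<lfloor>Re z + 1 / 2\<rfloor>"

definition inf_step :: "complex \<Rightarrow> complex" where
  "inf_step z = - 1 / (z - of_int (inf_digit z))"

definition inf_ends :: "complex \<Rightarrow> bool" where
  "inf_ends z \<longleftrightarrow> (\<exists>j. (inf_step ^^ j) z \<in> fund_dom)"

definition inf_length :: "complex \<Rightarrow> nat" where
  "inf_length z = (LEAST j. (inf_step ^^ j) z \<in> fund_dom)"

primrec inf_matrix :: "complex \<Rightarrow> nat \<Rightarrow> rat^2^2" where
  "inf_matrix z 0 = mat 1"
| "inf_matrix z (Suc j) =
     vector [vector [0, - 1], vector [1, - of_int (inf_digit ((inf_step ^^ j) z))]]
     ** inf_matrix z j"

definition cf_Q :: "(complex \<Rightarrow> 'p::prime_card padic alg_closure) \<Rightarrow> complex \<Rightarrow> rat^2^2" where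
  "cf_Q \<iota> x = inf_matrix (cf_z0 \<iota> x) (inf_length (cf_z0 \<iota> x))"

definition cf_next :: "(complex \<Rightarrow> 'p::prime_card padic alg_closure) \<Rightarrow> complex \<Rightarrow> complex" where
  "cf_next \<iota> x = (inf_step ^^ inf_length (cf_z0 \<iota> x)) (cf_z0 \<iota> x)"

text \<open>The complete quotients \<open>x\<^sub>1 = z, x\<^sub>2, \<dots>\<close> are indexed from 1.\<close>

definition cf_x :: "(complex \<Rightarrow> 'p::prime_card padic alg_closure) \<Rightarrow> complex \<Rightarrow> nat \<Rightarrow> complex" where
  "cf_x \<iota> z k = (cf_next \<iota> ^^ (k - 1)) z"

definition cf_A :: "(complex \<Rightarrow> 'p::prime_card padic alg_closure) \<Rightarrow> complex \<Rightarrow> nat \<Rightarrow> rat^2^2" where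
  "cf_A \<iota> z k = matrix_inv (cf_Q \<iota> (cf_x \<iota> z k) ** cf_P \<iota> (cf_x \<iota> z k) ** cf_D \<iota> (cf_x \<iota> z k))"

primrec cf_B :: "(complex \<Rightarrow> 'p::prime_card padic alg_closure) \<Rightarrow> complex \<Rightarrow> nat \<Rightarrow> rat^2^2" where
  "cf_B \<iota> z 0 = mat 1"
| "cf_B \<iota> z (Suc k) = cf_B \<iota> z k ** cf_A \<iota> z (Suc k)"

text \<open>
  Every \<open>\<infinity>\<close>-adic reduction occurring in the expansion of \<open>z\<close> ends.  If it does not,
  \<open>inf_length\<close>, and hence everything after it, has no meaning.
\<close>

definition cf_defined :: "(complex \<Rightarrow> 'p::prime_card padic alg_closure) \<Rightarrow> complex \<Rightarrow> bool" where
  "cf_defined \<iota> z \<longleftrightarrow> (\<forall>k\<ge>1. inf_ends (cf_z0 \<iota> (cf_x \<iota> z k)))"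


section \<open>Imaginary quadratic numbers and norm one p-units\<close>

definition imag_quadratic :: "complex \<Rightarrow> bool" where
  "imag_quadratic z \<longleftrightarrow> z \<notin> \<real> \<and>
     (\<exists>a b c :: int. a \<noteq> 0 \<and> of_int a * z ^ 2 + of_int b * z + of_int c = 0)"

definition sqrt_neg :: "nat \<Rightarrow> complex" where
  "sqrt_neg d = \<i> * of_real (sqrt (real d))"

definition imag_quad_field :: "nat \<Rightarrow> complex set" where
  "imag_quad_field d = {of_rat a + of_rat b * sqrt_neg d | a b. True}"

definition ring_of_integers :: "complex set \<Rightarrow> complex set" where
  "ring_of_integers F = {x \<in> F. algebraic_int x}"

definition p_integers :: "nat \<Rightarrow> complex set \<Rightarrow> complex set" where
  "p_integers p F = {x / of_nat p ^ n | x n. x \<in> ring_of_integers F}"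

text \<open>
  The non-trivial automorphism of an imaginary quadratic field is complex conjugation, so that
  \<open>x * cnj x\<close> is the norm of \<open>x\<close>.
\<close>

definition norm_one_p_units :: "nat \<Rightarrow> complex set \<Rightarrow> complex monoid" where
  "norm_one_p_units p F =
     \<lparr>carrier = {x \<in> p_integers p F. (\<exists>y \<in> p_integers p F. x * y = 1) \<and> x * cnj x = 1},
      monoid.mult = (*), one = 1\<rparr>"

definition torsion :: "('a, 'b) monoid_scheme \<Rightarrow> 'a set" where
  "torsion G = {x \<in> carrier G. \<exists>n::nat. n > 0 \<and> x [^]\<^bsub>G\<^esub> n = \<one>\<^bsub>G\<^esub>}"

text \<open>The image of \<open>g\<close> generates \<open>G\<close> modulo torsion, which is free abelian of rank one.\<close>

definition generates_mod_torsion :: "('a, 'b) monoid_scheme \<Rightarrow> 'a \<Rightarrow> bool" where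
  "generates_mod_torsion G g \<longleftrightarrow>
     g \<in> carrier G \<and>
     G Mod torsion G \<cong> integer_group \<and>
     generate (G Mod torsion G) {torsion G #>\<^bsub>G\<^esub> g} = carrier (G Mod torsion G)"

definition cf_theta :: "nat \<Rightarrow> complex" where
  "cf_theta d = (if [- int d = 1] (mod 4) then (- 1 + sqrt_neg d) / 2 else sqrt_neg d)"


text \<open>
  The \<open>\<infinity>\<close>-adic reduction can fail to end: \<open>exp(\<pi>i/3)\<close> lies outside \<open>fund_dom\<close> and is mapped to
  itself, while \<open>exp(2\<pi>i/3)\<close> is not a value of \<open>inf_step\<close>.  The reduction does end for every number of the upper half plane which is not in the
  field of the third roots of unity.
\<close>

lemma not_inf_ends: "\<not> inf_ends (cis (pi / 3))"
proof -
  have re: "Re (cis (pi / 3)) = 1 / 2" and im: "Im (cis (pi / 3)) = sqrt 3 / 2"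
    by (simp_all add: cos_60 sin_60)
  have "inf_digit (cis (pi / 3)) = 1" unfolding inf_digit_def re by simp
  then have "inf_step (cis (pi / 3)) = - 1 / (cis (pi / 3) - 1)" by (simp add: inf_step_def)
  also have "\<dots> = cis (pi / 3)"
    using re im by (auto simp: complex_eq_iff Re_divide Im_divide power2_eq_square field_simps)
  finally have "(inf_step ^^ j) (cis (pi / 3)) = cis (pi / 3)" for j
    by (induction j) simp_all
  moreover have "cis (pi / 3) \<notin> fund_dom"
  proof
    assume "cis (pi / 3) \<in> fund_dom"
    then obtain t where t: "t \<in> {pi / 2..2 * pi / 3}" "cis (pi / 3) = cis t"
      by (auto simp: fund_dom_def)
    have "cos t \<le> cos (pi / 2)" using t(1) by (intro cos_monotone_0_pi_le) auto
    then show False using t(2) re by (metis cis.sel(1) cos_pi_half not_one_le_zero zero_less_divide_iff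
      not_le zero_less_one zero_less_numeral)
  qed
  ultimately show ?thesis by (simp add: inf_ends_def)
qed

lemma inf_ends_step: "inf_ends (inf_step z) \<Longrightarrow> inf_ends z"
  unfolding inf_ends_def by (metis funpow_Suc_right o_apply)

lemma inf_ends_fund_dom: "z \<in> fund_dom \<Longrightarrow> inf_ends z"
  unfolding inf_ends_def by (rule exI[of _ 0]) simp

lemma imag_quad_field_add:
  "x \<in> imag_quad_field d \<Longrightarrow> y \<in> imag_quad_field d \<Longrightarrow> x + y \<in> imag_quad_field d"
proof -
  assume "x \<in> imag_quad_field d" "y \<in> imag_quad_field d"
  then obtain a b a' b' where "x = of_rat a + of_rat b * sqrt_neg d"
      "y = of_rat a' + of_rat b' * sqrt_neg d" by (auto simp: imag_quad_field_def)
  then have "x + y = of_rat (a + a') + of_rat (b + b') * sqrt_neg d"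
    by (simp add: of_rat_add algebra_simps)
  then show ?thesis unfolding imag_quad_field_def by blast
qed

lemma imag_quad_field_rat: "of_rat a \<in> imag_quad_field d"
  unfolding imag_quad_field_def by (rule CollectI, rule exI[of _ a], rule exI[of _ 0]) simp

lemma imag_quad_field_mult_rat:
  "x \<in> imag_quad_field d \<Longrightarrow> of_rat c * x \<in> imag_quad_field d"
proof -
  assume "x \<in> imag_quad_field d"
  then obtain a b where "x = of_rat a + of_rat b * sqrt_neg d" by (auto simp: imag_quad_field_def)
  then have "of_rat c * x = of_rat (c * a) + of_rat (c * b) * sqrt_neg d"
    by (simp add: of_rat_mult algebra_simps)
  then show ?thesis unfolding imag_quad_field_def by blast
qed

lemma imag_quad_field_inverse:
  "x \<in> imag_quad_field d \<Longrightarrow> - 1 / x \<in> imag_quad_field d"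
proof -
  assume "x \<in> imag_quad_field d"
  then obtain a b where x: "x = of_rat a + of_rat b * sqrt_neg d"
    by (auto simp: imag_quad_field_def)
  let ?y = "of_rat a + of_rat (- b) * sqrt_neg d"
  have s: "sqrt_neg d * sqrt_neg d = - of_nat d"
    by (simp add: sqrt_neg_def complex_eq_iff)
  have "x * ?y = of_rat (a * a) - of_rat (b * b) * (sqrt_neg d * sqrt_neg d)"
    unfolding x by (simp add: of_rat_minus of_rat_mult algebra_simps)
  then have xy: "x * ?y = of_rat (a * a + of_nat d * (b * b))"
    by (simp add: s of_rat_add of_rat_mult)
  have "- 1 / x = of_rat (- 1 / (a * a + of_nat d * (b * b))) * ?y"
  proof (cases "a * a + of_nat d * (b * b) = 0")
    case True
    moreover have "0 \<le> a * a" "0 \<le> of_nat d * (b * b)" by simp_all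
    ultimately have "a = 0" "d = 0 \<or> b = 0" by (auto simp: add_nonneg_eq_0_iff)
    then show ?thesis by (auto simp: sqrt_neg_def x)
  next
    case False
    then have "x * ?y \<noteq> 0" unfolding xy by simp
    then have "- 1 / x = (- 1) * ?y / (x * ?y)"
      by (metis mult_divide_mult_cancel_right mult_not_zero)
    also have "\<dots> = of_rat (- 1 / (a * a + of_nat d * (b * b))) * ?y"
      unfolding xy by (simp only: of_rat_divide of_rat_minus of_rat_1 times_divide_eq_left)
    finally show ?thesis .
  qed
  moreover have "?y \<in> imag_quad_field d" unfolding imag_quad_field_def by blast
  ultimately show ?thesis using imag_quad_field_mult_rat by simp
qed

lemma finite_small_forms:
  assumes "Im z > 0"
  shows "finite {(c :: int, d :: int). cmod (of_int c * z + of_int d) < 1}" (is "finite ?S")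
proof -
  define A where "A = \<lceil>1 / Im z\<rceil>"
  define B where "B = \<lceil>1 + of_int A * cmod z\<rceil>"
  have "?S \<subseteq> {- A..A} \<times> {- B..B}"
  proof safe
    fix c d :: int assume *: "cmod (of_int c * z + of_int d) < 1"
    have "\<bar>of_int c * Im z\<bar> < 1"
      using * abs_Im_le_cmod[of "of_int c * z + of_int d"] by simp
    then have "\<bar>real_of_int c\<bar> < 1 / Im z" using assms by (simp add: abs_mult field_simps)
    also have "\<dots> \<le> of_int A" unfolding A_def by simp
    finally have c: "\<bar>real_of_int c\<bar> \<le> of_int A" by simp
    then show "c \<in> {- A..A}" by auto
    have "\<bar>real_of_int d\<bar> = cmod (of_int c * z + of_int d - of_int c * z)" by simp
    also have "\<dots> \<le> cmod (of_int c * z + of_int d) + cmod (of_int c * z)" by (rule norm_triangle_ineq4)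
    also have "\<dots> \<le> 1 + of_int A * cmod z"
      using * c by (simp add: norm_mult add_mono mult_right_mono)
    also have "\<dots> \<le> of_int B" unfolding B_def by simp
    finally show "d \<in> {- B..B}" by auto
  qed
  then show ?thesis by (rule finite_subset) simp
qed

lemma fund_dom_arc:
  assumes "cmod w = 1" "Im w > 0" "- 1 / 2 \<le> Re w" "Re w \<le> 0"
  shows "w \<in> fund_dom"
proof -
  have sq: "Im w ^ 2 = 1 - Re w ^ 2" using assms(1) cmod_power2[of w] by simp
  then have im: "Im w = sqrt (1 - Re w ^ 2)" using assms(2) by (simp add: real_sqrt_unique)
  have "w = cis (arccos (Re w))"
    using assms(3,4) by (simp add: complex_eq_iff im sin_arccos)
  moreover have "arccos 0 \<le> arccos (Re w)" using assms(3,4) by (intro arccos_le_arccos) auto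
  moreover have "arccos (Re w) \<le> arccos (- 1 / 2)"
    using assms(3,4) by (intro arccos_le_arccos) auto
  moreover have "arccos (- 1 / 2) = 2 * pi / 3"
    using arccos_cos[of "2 * pi / 3"] cos_120 by simp
  ultimately show ?thesis by (auto simp: fund_dom_def)
qed

lemma inf_ends_generic:
  assumes "Im z > 0" "z \<notin> imag_quad_field 3"
  shows "inf_ends z"
  using assms
proof (induction "card {(c :: int, d :: int). cmod (of_int c * z + of_int d) < 1}"
    arbitrary: z rule: less_induct)
  case less
  define b where "b = inf_digit z"
  define w where "w = z - of_int b"
  have step: "inf_step z = - 1 / w" by (simp add: inf_step_def w_def b_def)
  have z: "z = w + of_int b" by (simp add: w_def)
  have w_im: "Im w > 0" using less.prems by (simp add: w_def)
  then have "w \<noteq> 0" by auto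
  have w_re: "- 1 / 2 \<le> Re w" "Re w < 1 / 2"
    unfolding w_def b_def inf_digit_def by (simp_all, linarith+)
  have w_K: "w \<notin> imag_quad_field 3"
    using less.prems(2) imag_quad_field_add[of w 3 "of_rat (of_int b)"]
      imag_quad_field_rat[of "of_int b" 3]
    by (auto simp: z)
  have Re_inv: "Re (- 1 / w) = - Re w / cmod w ^ 2"
    by (simp add: Re_divide cmod_power2)
  have Im_inv: "Im (- 1 / w) = Im w / cmod w ^ 2"
    by (simp add: Im_divide cmod_power2)
  have step_inv: "inf_step (- 1 / w) = w" if "- 1 / 2 \<le> Re (- 1 / w)" "Re (- 1 / w) < 1 / 2"
  proof -
    have "inf_digit (- 1 / w) = 0"
      unfolding inf_digit_def using that by (intro floor_unique) (simp_all del: Re_divide)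
    then show ?thesis by (simp add: inf_step_def)
  qed
  have "inf_ends (- 1 / w)"
  proof (cases "cmod w" "1 :: real" rule: linorder_cases)
    case greater
    have "1 < cmod w ^ 2" using greater by (simp add: one_less_power)
    then have "\<bar>Re w\<bar> < cmod w ^ 2 / 2" using w_re by (simp add: abs_if)
    then have "- 1 / 2 \<le> Re (- 1 / w)" "Re (- 1 / w) < 1 / 2"
      unfolding Re_inv using \<open>w \<noteq> 0\<close> by (auto simp: field_simps abs_less_iff)
    moreover have "w \<in> fund_dom" using greater w_im w_re by (simp add: fund_dom_def)
    ultimately show ?thesis using step_inv inf_ends_fund_dom inf_ends_step by metis
  next
    case equal
    show ?thesis
    proof (cases "Re w \<le> 0")
      case True
      have "Re w \<noteq> - 1 / 2"
      proof
        assume re: "Re w = - 1 / 2"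
        have "Im w ^ 2 = 3 / 4"
          using equal cmod_power2[of w] re by (simp add: power2_eq_square)
        then have "Im w = sqrt (3 / 4)" using w_im by (simp add: real_sqrt_unique)
        then have "w = of_rat (- 1 / 2) + of_rat (1 / 2) * sqrt_neg 3"
          using re by (simp add: complex_eq_iff sqrt_neg_def real_sqrt_divide of_rat_divide of_rat_minus)
        then show False using w_K unfolding imag_quad_field_def by blast
      qed
      then have "- 1 / 2 \<le> Re (- 1 / w)" "Re (- 1 / w) < 1 / 2"
        unfolding Re_inv using True w_re equal by auto
      moreover have "w \<in> fund_dom" using fund_dom_arc equal w_im w_re True by blast
      ultimately show ?thesis using step_inv inf_ends_fund_dom inf_ends_step by metis
    next
      case False
      have "cmod (- 1 / w) = 1" using equal by (simp add: norm_divide)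
      moreover have "Im (- 1 / w) > 0" unfolding Im_inv using equal w_im by simp
      moreover have "- 1 / 2 \<le> Re (- 1 / w)" "Re (- 1 / w) \<le> 0"
        unfolding Re_inv using False w_re equal by auto
      ultimately show ?thesis using fund_dom_arc inf_ends_fund_dom by blast
    qed
  next
    case small: less
    let ?S = "\<lambda>z. {(c :: int, d :: int). cmod (of_int c * z + of_int d) < 1}"
    let ?f = "\<lambda>(c :: int, d :: int). (d, - c - d * b)"
    have inj: "inj ?f" by (auto simp: inj_def)
    have "?f ` ?S (- 1 / w) \<subseteq> ?S z"
    proof safe
      fix c d :: int assume *: "cmod (of_int c * (- 1 / w) + of_int d) < 1"
      have "of_int d * z + of_int (- c - d * b) = w * (of_int c * (- 1 / w) + of_int d)"
        using \<open>w \<noteq> 0\<close> by (simp add: z algebra_simps)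
      then have "cmod (of_int d * z + of_int (- c - d * b))
          = cmod w * cmod (of_int c * (- 1 / w) + of_int d)" by (simp only: norm_mult)
      also have "\<dots> < 1 * 1" using small * by (intro mult_strict_mono') auto
      finally show "cmod (of_int d * z + of_int (- c - d * b)) < 1" by simp
    qed
    moreover have "(1, - b) \<in> ?S z" using small by (simp add: z)
    moreover have "(1, - b) \<notin> ?f ` ?S (- 1 / w)"
    proof
      assume "(1, - b) \<in> ?f ` ?S (- 1 / w)"
      then have "(0, 1) \<in> ?S (- 1 / w)" by auto
      then show False by simp
    qed
    ultimately have "?f ` ?S (- 1 / w) \<subset> ?S z" by blast
    then have "card (?f ` ?S (- 1 / w)) < card (?S z)"
      using finite_small_forms less.prems(1) by (intro psubset_card_mono) auto
    then have "card (?S (- 1 / w)) < card (?S z)"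
      using inj by (simp add: card_image inj_on_subset)
    moreover have "Im (- 1 / w) > 0" unfolding Im_inv using w_im \<open>w \<noteq> 0\<close> by simp
    moreover have "- 1 / w \<notin> imag_quad_field 3"
    proof
      assume "- 1 / w \<in> imag_quad_field 3"
      then have "- 1 / (- 1 / w) \<in> imag_quad_field 3" by (rule imag_quad_field_inverse)
      then show False using w_K by simp
    qed
    ultimately show ?thesis using less.hyps by blast
  qed
  then show ?case using inf_ends_step step by metis
qed

lemma half_plane_inverse: "Im x > 0 \<Longrightarrow> Im (- 1 / x) > 0"
  by (auto simp: Im_divide intro!: divide_pos_pos add_nonneg_pos)

lemma not_imag_quad_field_inverse:
  "x \<notin> imag_quad_field d \<Longrightarrow> - 1 / x \<notin> imag_quad_field d"
  using imag_quad_field_inverse[of "- 1 / x" d] by auto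

lemma cf_z0_generic:
  fixes \<iota> :: "complex \<Rightarrow> 'p::prime_card padic alg_closure"
  assumes "Im x > 0" "x \<notin> imag_quad_field 3"
  shows "Im (cf_z0 \<iota> x) > 0 \<and> cf_z0 \<iota> x \<notin> imag_quad_field 3"
proof -
  have p: "CARD('p) > 0" using prime_gt_0_nat[OF prime_card] .
  let ?y = "cf_init \<iota> x" and ?a = "cf_a \<iota> x" and ?q = "CARD('p) ^ 2"
  have y: "Im ?y > 0" "?y \<notin> imag_quad_field 3"
    using assms half_plane_inverse not_imag_quad_field_inverse by (auto simp: cf_init_def)
  have eq: "?y = of_rat (of_nat ?q) * cf_z0 \<iota> x + of_rat (of_nat ?a)"
    using p by (simp add: cf_z0_def of_rat_power)
  have "cf_z0 \<iota> x = (?y - of_nat ?a) / of_real (real ?q)" by (simp add: cf_z0_def)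
  then have "Im (cf_z0 \<iota> x) = Im ?y / real ?q" by (simp only: Im_divide_of_real) simp
  then have "Im (cf_z0 \<iota> x) > 0" using y p by simp
  moreover have "cf_z0 \<iota> x \<notin> imag_quad_field 3"
    using y(2) eq imag_quad_field_add imag_quad_field_mult_rat imag_quad_field_rat by metis
  ultimately show ?thesis ..
qed

lemma inf_step_generic:
  assumes "Im x > 0" "x \<notin> imag_quad_field 3"
  shows "Im (inf_step x) > 0 \<and> inf_step x \<notin> imag_quad_field 3"
proof -
  have "x = (x - of_int (inf_digit x)) + of_rat (of_int (inf_digit x))" by simp
  then have "x - of_int (inf_digit x) \<notin> imag_quad_field 3"
    using assms(2) imag_quad_field_add imag_quad_field_rat by metis
  then show ?thesis
    using assms half_plane_inverse[of "x - of_int (inf_digit x)"] not_imag_quad_field_inverse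
    by (auto simp: inf_step_def)
qed

lemma cf_defined_generic:
  assumes "Im z > 0" "z \<notin> imag_quad_field 3"
  shows "cf_defined \<iota> z"
proof -
  have iter: "Im ((inf_step ^^ j) x) > 0 \<and> (inf_step ^^ j) x \<notin> imag_quad_field 3"
    if "Im x > 0" "x \<notin> imag_quad_field 3" for x j
    using that by (induction j) (use inf_step_generic in auto)
  have "Im (cf_x \<iota> z k) > 0 \<and> cf_x \<iota> z k \<notin> imag_quad_field 3" for k
  proof -
    have "Im ((cf_next \<iota> ^^ m) z) > 0 \<and> (cf_next \<iota> ^^ m) z \<notin> imag_quad_field 3" for m
      using assms by (induction m) (use iter cf_z0_generic in \<open>auto simp: cf_next_def\<close>)
    then show ?thesis by (simp add: cf_x_def)
  qed
  then show ?thesis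
    unfolding cf_defined_def using inf_ends_generic cf_z0_generic by blast
qed

end

theory Submission
  imports Defs
begin

text \<open>
  Let \<open>R\<close> be the ring of p-adic integers inside the complex numbers.  The theorem rests on what one
  p-adic reduction \<open>z \<mapsto> (z - a) / p\<^sup>2\<close> does to quadratic equations and to lattices.

  The discriminant does not change.  If \<open>f = A X\<^sup>2 + B X + C\<close> vanishes at \<open>z \<in> R\<close>, then
  \<open>f a = (a - z) (A (a + z) + B)\<close> is an integer lying in \<open>p\<^sup>2 R\<close>, hence a multiple of \<open>p\<^sup>2\<close>, and
  \<open>(z - a) / p\<^sup>2\<close> is a root of \<open>A p\<^sup>2 X\<^sup>2 + f' a X + f a / p\<^sup>2\<close>
  (\<open>quad_root_padic_reduction\<close>).  Translations and \<open>z \<mapsto> - 1 / z\<close> preserve the discriminant as well.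
  So all complete quotients but the first are points of the fundamental domain which satisfy an
  integral quadratic equation of one fixed negative discriminant.  There are finitely many of those
  (\<open>finite_fund_dom_quad_root\<close>), and the pigeonhole principle gives the first part.

  For the second part let \<open>(\<alpha>\<^sub>n, \<beta>\<^sub>n)\<close> be the image of \<open>(\<theta>, 1)\<close> under the product of the first \<open>n\<close> step
  matrices, so that \<open>\<alpha>\<^sub>n / \<beta>\<^sub>n\<close> is the complete quotient after \<open>n\<close> steps.  The prime splits in the
  field, as \<open>\<pp> \<pp>'\<close> say, where \<open>\<pp>\<close> is the prime belonging to the given embedding.  In terms of ideals a
  step multiplies the lattice spanned by \<open>\<alpha>\<^sub>n\<close> and \<open>\<beta>\<^sub>n\<close> by \<open>\<pp>\<^sup>2 / p = \<pp> / \<pp>'\<close>.  All that is used of this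
  is elementary: \<open>\<alpha>\<^sub>n\<close> and \<open>\<beta>\<^sub>n\<close> have p-adic order at least \<open>n\<close>, their conjugates have order at least
  \<open>- n\<close>, and \<open>\<alpha>\<^sub>n \<beta>\<^sub>n' - \<alpha>\<^sub>n' \<beta>\<^sub>n = \<theta> - \<theta>'\<close> is a p-adic unit, the dashes denoting conjugates.

  Let \<open>u\<close> be a p-unit of norm one and of order \<open>n > 0\<close>.  Then \<open>u = g \<alpha>\<^sub>n + h \<beta>\<^sub>n\<close> with \<open>g\<close> and \<open>h\<close> in
  \<open>\<int>[1/p]\<close>; by Cramer's rule \<open>g (\<theta> - \<theta>')\<close> and \<open>h (\<theta> - \<theta>')\<close> are p-adic integers, so \<open>g\<close> and \<open>h\<close> are integers.
  With \<open>x = \<alpha>\<^sub>n / \<beta>\<^sub>n\<close> this gives \<open>1 = \<bar>u\<bar> = \<bar>\<beta>\<^sub>n\<bar> \<bar>g x + h\<bar> \<ge> \<bar>\<beta>\<^sub>n\<bar>\<close>, because a non-zero integral linear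
  form has absolute value at least one on the fundamental domain.  Hence the imaginary part of \<open>x\<close> is
  at least that of \<open>\<theta>\<close>, so the equation of \<open>x\<close> has leading coefficient \<open>1\<close> up to sign, and \<open>x = \<theta>\<close>
  (\<open>unit_gives_return\<close>).  Conversely, if \<open>x = \<theta>\<close> then \<open>\<beta>\<^sub>n\<close> is a p-unit of norm one and of order exactly
  \<open>n\<close> (\<open>return_gives_unit\<close>).  The positive orders of p-units of norm one are therefore exactly the
  lengths of the returns to \<open>\<theta>\<close>, and the shortest return gives a p-unit of least positive order.  As
  units of order zero are roots of unity, it generates the group modulo torsion.  A return exists,
  because two equal complete quotients, after \<open>m < n\<close> steps, produce the unit \<open>\<beta>\<^sub>n / \<beta>\<^sub>m\<close> of order
  \<open>n - m\<close> (\<open>exists_return\<close>).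
\<close>

section \<open>Divisibility and units in the p-adic integers\<close>

lemma CARD_prime_int: "Factorial_Ring.prime (int CARD('p::prime_card))"
  using prime_card[where 'a = 'p] by simp

lemma CARD_pos: "int CARD('p::prime_card) > 0"
  using prime_gt_0_nat[OF prime_card[where 'a = 'p]] by simp

lemma Rep_padic_int_range:
  fixes x :: "'p::prime_card padic_int"
  shows "0 \<le> Rep_padic_int x n" "Rep_padic_int x n < int CARD('p) ^ n"
  using Rep_padic_int[of x] by auto

lemma Rep_padic_int_mod:
  fixes x :: "'p::prime_card padic_int"
  assumes "m \<le> n"
  shows "Rep_padic_int x n mod int CARD('p) ^ m = Rep_padic_int x m"
  using padic_int_mod[of x m "n - m"] assms by simp

lemma Rep_padic_int_of_nat:
  "Rep_padic_int (of_nat k :: 'p::prime_card padic_int) n = int k mod int CARD('p) ^ n"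
  by (induction k)
    (simp_all add: zero_padic_int.rep_eq one_padic_int.rep_eq plus_padic_int.rep_eq mod_simps)

lemma Rep_padic_int_of_int:
  "Rep_padic_int (of_int k :: 'p::prime_card padic_int) n = k mod int CARD('p) ^ n"
  by (cases k)
    (simp_all add: Rep_padic_int_of_nat uminus_padic_int.rep_eq one_padic_int.rep_eq
      minus_padic_int.rep_eq mod_simps)

lemma padic_int_eqI:
  "(\<And>n. Rep_padic_int x n = Rep_padic_int y n) \<Longrightarrow> x = y"
  by (metis Rep_padic_int_inject ext)

lemma Abs_padic_int_rep:
  assumes "\<And>n. 0 \<le> f n \<and> f n < int CARD('p::prime_card) ^ n"
    and "\<And>n. f (Suc n) mod int CARD('p) ^ n = f n"
  shows "Rep_padic_int (Abs_padic_int f :: 'p padic_int) = f"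
  by (rule Abs_padic_int_inverse) (use assms in auto)

text \<open>
  The quotient is found digit by digit: its residue modulo \<open>p\<^sup>m\<close> is the residue of \<open>x\<close> modulo
  \<open>p\<^sup>n\<^sup>+\<^sup>m\<close>, divided by \<open>p\<^sup>n\<close>.
\<close>

lemma padic_int_power_dvd:
  fixes x :: "'p::prime_card padic_int"
  assumes "Rep_padic_int x n = 0"
  obtains y where "x = of_nat (CARD('p) ^ n) * y"
proof -
  let ?p = "int CARD('p)"
  have p: "?p > 0" by (rule CARD_pos)
  define f where "f = (\<lambda>m. Rep_padic_int x (n + m) div ?p ^ n)"
  have dvd: "?p ^ n dvd Rep_padic_int x (n + m)" for m
    using padic_int_mod[of x n m] assms by auto
  have mult: "?p ^ n * f m = Rep_padic_int x (n + m)" for m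
    using dvd[of m] by (simp add: f_def)
  have "0 \<le> f m \<and> f m < ?p ^ m" for m
  proof -
    have "?p ^ n * f m < ?p ^ n * ?p ^ m"
      using Rep_padic_int_range(2)[of x "n + m"] mult by (simp add: power_add)
    moreover have "0 \<le> f m" using p Rep_padic_int_range(1)[of x "n + m"]
      by (simp add: f_def pos_imp_zdiv_nonneg_iff)
    ultimately show ?thesis using p by simp
  qed
  moreover have "f (Suc m) mod ?p ^ m = f m" for m
  proof -
    have "?p ^ n * (f (Suc m) mod ?p ^ m) = Rep_padic_int x (n + Suc m) mod ?p ^ (n + m)"
      by (simp add: power_add mult_mod_right mult del: power_Suc)
    also have "\<dots> = ?p ^ n * f m" by (simp add: Rep_padic_int_mod mult)
    finally show ?thesis using p by simp
  qed
  ultimately have rep: "Rep_padic_int (Abs_padic_int f :: 'p padic_int) = f"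
    by (rule Abs_padic_int_rep)
  have "x = of_nat (CARD('p) ^ n) * Abs_padic_int f"
  proof (rule padic_int_eqI)
    fix m
    have "Rep_padic_int (of_nat (CARD('p) ^ n) * Abs_padic_int f :: 'p padic_int) m
        = (?p ^ n * f m) mod ?p ^ m"
      by (simp add: times_padic_int.rep_eq Rep_padic_int_of_nat rep mod_simps del: of_nat_power)
         (simp add: mod_simps)
    also have "\<dots> = Rep_padic_int x m" by (simp add: mult Rep_padic_int_mod)
    finally show "Rep_padic_int x m
        = Rep_padic_int (of_nat (CARD('p) ^ n) * Abs_padic_int f :: 'p padic_int) m" ..
  qed
  then show ?thesis by (rule that)
qed

text \<open>
  The residues of \<open>x\<close> are invertible modulo all powers of \<open>p\<close>, and the inverse residues fit together
  because an inverse modulo \<open>p\<^sup>n\<close> is unique.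
\<close>

lemma padic_int_is_unit:
  fixes x :: "'p::prime_card padic_int"
  assumes "Rep_padic_int x 1 \<noteq> 0"
  obtains y where "x * y = 1"
proof -
  let ?p = "int CARD('p)"
  have p: "?p > 0" by (rule CARD_pos)
  have cop: "coprime (Rep_padic_int x n) (?p ^ n)" for n
  proof (cases n)
    case (Suc m)
    have "Rep_padic_int x n mod ?p = Rep_padic_int x 1"
      using Rep_padic_int_mod[of 1 n x] Suc by simp
    then have "\<not> ?p dvd Rep_padic_int x n" using assms by auto
    then show ?thesis
      using prime_imp_coprime[OF CARD_prime_int[where 'p = 'p]] by (simp add: coprime_commute)
  qed simp
  have "\<exists>y. 0 \<le> y \<and> y < ?p ^ n \<and> [Rep_padic_int x n * y = 1] (mod ?p ^ n)" for n
  proof -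
    obtain y where y: "[Rep_padic_int x n * y = 1] (mod ?p ^ n)"
      using cong_solve_coprime_int[OF cop] by blast
    then have "[Rep_padic_int x n * (y mod ?p ^ n) = 1] (mod ?p ^ n)"
      by (simp add: cong_def mod_simps)
    then show ?thesis using p by (intro exI[of _ "y mod ?p ^ n"]) simp
  qed
  then obtain f where f: "\<And>n. 0 \<le> f n \<and> f n < ?p ^ n"
    "\<And>n. [Rep_padic_int x n * f n = 1] (mod ?p ^ n)"
    by metis
  have "f (Suc n) mod ?p ^ n = f n" for n
  proof -
    have "[Rep_padic_int x (Suc n) * f (Suc n) = 1] (mod ?p ^ n)"
      using f(2)[of "Suc n"] by (rule cong_dvd_modulus) simp
    moreover have "[Rep_padic_int x (Suc n) = Rep_padic_int x n] (mod ?p ^ n)"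
      using Rep_padic_int_mod[of n "Suc n" x] by (simp add: cong_def Rep_padic_int_mod)
    ultimately have "[Rep_padic_int x n * f (Suc n) = 1] (mod ?p ^ n)"
      by (metis cong_scalar_right cong_sym cong_trans)
    then have "[Rep_padic_int x n * f (Suc n) = Rep_padic_int x n * f n] (mod ?p ^ n)"
      using f(2)[of n] cong_sym cong_trans by blast
    then have "[f (Suc n) = f n] (mod ?p ^ n)"
      using cop by (simp add: cong_mult_lcancel)
    then show ?thesis using f(1)[of n] by (simp add: cong_def)
  qed
  then have rep: "Rep_padic_int (Abs_padic_int f :: 'p padic_int) = f"
    by (rule Abs_padic_int_rep[OF f(1)])
  have "x * Abs_padic_int f = 1"
    by (rule padic_int_eqI)
      (use f(2) in \<open>simp add: times_padic_int.rep_eq rep one_padic_int.rep_eq cong_def\<close>)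
  then show ?thesis by (rule that)
qed

lemma padic_int_decompose:
  fixes x :: "'p::prime_card padic_int"
  assumes "x \<noteq> 0"
  obtains n w w' where "x = of_nat (CARD('p) ^ n) * w" "w * w' = 1"
proof -
  have "\<exists>n. Rep_padic_int x n \<noteq> 0"
    using assms padic_int_eqI[of x 0] by (auto simp: zero_padic_int.rep_eq)
  moreover have "Rep_padic_int x 0 = 0" using Rep_padic_int_range[of x 0] by simp
  ultimately obtain n where n: "Rep_padic_int x n = 0" "Rep_padic_int x (Suc n) \<noteq> 0"
    using ex_least_nat_less[of "\<lambda>n. Rep_padic_int x n \<noteq> 0"] by auto
  obtain w where w: "x = of_nat (CARD('p) ^ n) * w" using padic_int_power_dvd[OF n(1)] .
  have "Rep_padic_int w 1 \<noteq> 0"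
  proof
    assume "Rep_padic_int w 1 = 0"
    then obtain y where "w = of_nat (CARD('p) ^ 1) * y" by (rule padic_int_power_dvd)
    then have x: "x = of_nat (CARD('p) ^ Suc n) * y" using w by (simp add: algebra_simps)
    have "Rep_padic_int x (Suc n) = 0"
      unfolding x times_padic_int.rep_eq Rep_padic_int_of_nat by (simp del: power_Suc)
    then show False using n(2) by simp
  qed
  then obtain w' where "w * w' = 1" by (rule padic_int_is_unit)
  then show ?thesis using w that by blast
qed

section \<open>The p-adic numbers inside the complex numbers\<close>

text \<open>
  The prime as a complex number is the parameter \<open>P\<close>: as a constant it would depend on the type
  \<open>'p\<close> alone and would have to carry that type as an argument.
\<close>

locale padic_identification =
  fixes \<iota> :: "complex \<Rightarrow> 'p::prime_card padic alg_closure"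
    and P :: complex
  assumes isom: "field_isom \<iota>"
    and P_def: "P = of_nat CARD('p)"
begin

abbreviation K :: "complex set" where "K \<equiv> padic_numbers \<iota>"
abbreviation R :: "complex set" where "R \<equiv> padic_integers \<iota>"

lemma P_nonzero [simp]: "P \<noteq> 0"
  using CARD_pos[where 'p = 'p] by (simp add: P_def)

lemma of_nat_P: "of_nat (CARD('p) ^ n) = P ^ n"
  by (simp add: P_def)

lemma iota_simps:
  shows "\<iota> (x + y) = \<iota> x + \<iota> y" "\<iota> (x * y) = \<iota> x * \<iota> y" "\<iota> (x - y) = \<iota> x - \<iota> y"
    "\<iota> (- x) = - \<iota> x" "\<iota> (x / y) = \<iota> x / \<iota> y" "\<iota> 0 = 0" "\<iota> 1 = 1"
    "\<iota> (of_nat n) = of_nat n" "\<iota> (of_int i) = of_int i" "\<iota> (x ^ n) = \<iota> x ^ n"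
    "\<iota> x = \<iota> y \<longleftrightarrow> x = y" "\<iota> x = 0 \<longleftrightarrow> x = 0"
proof -
  interpret I: field_isom \<iota> by (rule isom)
  show "\<iota> (x + y) = \<iota> x + \<iota> y" "\<iota> (x * y) = \<iota> x * \<iota> y" "\<iota> (x - y) = \<iota> x - \<iota> y"
    "\<iota> (- x) = - \<iota> x" "\<iota> (x / y) = \<iota> x / \<iota> y" "\<iota> 0 = 0" "\<iota> 1 = 1"
    "\<iota> (x ^ n) = \<iota> x ^ n" "\<iota> x = \<iota> y \<longleftrightarrow> x = y" "\<iota> x = 0 \<longleftrightarrow> x = 0"
    by (simp_all add: hom_distribs)
  show "\<iota> (of_nat n) = of_nat n" by (induction n) (simp_all add: hom_distribs)
  then show "\<iota> (of_int i) = of_int i" by (cases i) (simp_all add: hom_distribs)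
qed

definition embed :: "'p padic_int \<Rightarrow> complex" where
  "embed u = (THE z. \<iota> z = to_ac (Fract u 1))"

lemma iota_embed: "\<iota> (embed u) = to_ac (Fract u 1)"
proof -
  interpret I: field_isom \<iota> by (rule isom)
  obtain z where "\<iota> z = to_ac (Fract u 1)" using I.surj by (metis surjD)
  then show ?thesis
    unfolding embed_def by (intro theI[of "\<lambda>z. \<iota> z = to_ac (Fract u 1)"]) (auto simp: iota_simps)
qed

lemma embed_eq_iff: "embed u = embed v \<longleftrightarrow> u = v"
proof -
  have "embed u = embed v \<longleftrightarrow> \<iota> (embed u) = \<iota> (embed v)" by (simp only: iota_simps)
  also have "\<dots> \<longleftrightarrow> u = v" by (simp add: iota_embed eq_fract)
  finally show ?thesis .
qed

lemma embed_eqI: "\<iota> z = to_ac (Fract u 1) \<Longrightarrow> z = embed u"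
  using iota_embed[of u] by (metis iota_simps(11))

lemma embed_add: "embed (u + v) = embed u + embed v"
  by (rule sym, rule embed_eqI) (simp add: iota_simps iota_embed flip: to_ac_add)

lemma embed_mult: "embed (u * v) = embed u * embed v"
  by (rule sym, rule embed_eqI) (simp add: iota_simps iota_embed flip: to_ac_mult)

lemma embed_of_nat: "embed (of_nat n) = of_nat n"
  by (rule sym, rule embed_eqI) (simp add: iota_simps flip: of_nat_fract)

lemma embed_of_int: "embed (of_int i) = of_int i"
proof (cases i)
  case (neg n)
  have "embed (of_int i) + embed (of_nat (Suc n)) = embed (of_nat 0)"
    unfolding neg embed_add[symmetric] by (simp del: of_nat_Suc)
  then show ?thesis unfolding embed_of_nat by (simp add: neg add_eq_0_iff2 del: of_nat_Suc)
qed (simp add: embed_of_nat)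

lemma R_eq: "R = range embed"
  unfolding padic_integers_def using iota_embed embed_eqI by fastforce

lemma R_of_int [simp]: "of_int i \<in> R"
  unfolding R_eq by (metis embed_of_int rangeI)

lemma R_of_nat [simp]: "of_nat n \<in> R"
  using R_of_int[of "int n"] by simp

lemma R_zero [simp]: "0 \<in> R" and R_one [simp]: "1 \<in> R"
  using R_of_int[of 0] R_of_int[of 1] by simp_all

lemma R_P [simp]: "P \<in> R"
  by (simp add: P_def)

lemma R_add: "x \<in> R \<Longrightarrow> y \<in> R \<Longrightarrow> x + y \<in> R"
  unfolding R_eq by (auto simp flip: embed_add)

lemma R_mult: "x \<in> R \<Longrightarrow> y \<in> R \<Longrightarrow> x * y \<in> R"
  unfolding R_eq by (auto simp flip: embed_mult)

lemma R_uminus: "x \<in> R \<Longrightarrow> - x \<in> R"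
  using R_mult[of "of_int (- 1)" x] R_of_int[of "- 1"] by simp

lemma R_diff: "x \<in> R \<Longrightarrow> y \<in> R \<Longrightarrow> x - y \<in> R"
  using R_add[of x "- y"] R_uminus[of y] by simp

lemma R_power: "x \<in> R \<Longrightarrow> x ^ n \<in> R"
  by (induction n) (auto intro: R_mult)

lemma K_I: "\<iota> z = to_ac x \<Longrightarrow> z \<in> K"
  by (auto simp: padic_numbers_def)

lemma K_E: assumes "z \<in> K" obtains x where "\<iota> z = to_ac x"
  using assms by (auto simp: padic_numbers_def)

lemma R_subset_K: "x \<in> R \<Longrightarrow> x \<in> K"
  by (auto simp: padic_integers_def padic_numbers_def)

lemma K_add: "x \<in> K \<Longrightarrow> y \<in> K \<Longrightarrow> x + y \<in> K"
  unfolding padic_numbers_def by (auto simp: iota_simps simp flip: to_ac_add)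

lemma K_diff: "x \<in> K \<Longrightarrow> y \<in> K \<Longrightarrow> x - y \<in> K"
  unfolding padic_numbers_def by (auto simp: iota_simps simp flip: to_ac_diff)

lemma K_mult: "x \<in> K \<Longrightarrow> y \<in> K \<Longrightarrow> x * y \<in> K"
  unfolding padic_numbers_def by (auto simp: iota_simps simp flip: to_ac_mult)

lemma K_divide: "x \<in> K \<Longrightarrow> y \<in> K \<Longrightarrow> x / y \<in> K"
  unfolding padic_numbers_def by (auto simp: iota_simps simp flip: to_ac_divide)

lemma K_of_int [simp]: "of_int n \<in> K"
  by (rule R_subset_K) simp

lemma K_of_nat [simp]: "of_nat n \<in> K"
  by (rule R_subset_K) simp

lemma K_P [simp]: "P ^ n \<in> K"
  by (rule R_subset_K) (simp add: R_power)

lemma R_residue: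
  assumes "x \<in> R"
  obtains a where "a < CARD('p) ^ n" "(x - of_nat a) / P ^ n \<in> R"
proof -
  obtain u where u: "x = embed u" using assms by (auto simp: R_eq)
  define a where "a = nat (Rep_padic_int u n)"
  have a: "int a = Rep_padic_int u n" using Rep_padic_int_range(1)[of u n] by (simp add: a_def)
  then have "int a < int (CARD('p) ^ n)" using Rep_padic_int_range(2)[of u n] by simp
  then have "a < CARD('p) ^ n" by (simp only: of_nat_less_iff)
  have "Rep_padic_int (u - of_nat a) n = 0"
    using a by (simp add: minus_padic_int.rep_eq Rep_padic_int_of_nat mod_simps)
  then obtain v where v: "u - of_nat a = of_nat (CARD('p) ^ n) * v" by (rule padic_int_power_dvd)
  then have "u = of_nat a + of_nat (CARD('p) ^ n) * v" by (simp add: algebra_simps)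
  then have "x = of_nat a + of_nat (CARD('p) ^ n) * embed v"
    unfolding u by (simp only: embed_add embed_mult embed_of_nat)
  then have "(x - of_nat a) / P ^ n = embed v" by (simp add: of_nat_P del: of_nat_power)
  then show ?thesis using \<open>a < CARD('p) ^ n\<close> that by (auto simp: R_eq)
qed

lemma R_int_dvd:
  assumes "of_int i / P ^ n \<in> R"
  shows "int CARD('p) ^ n dvd i"
proof -
  obtain u where "of_int i / P ^ n = embed u" using assms by (auto simp: R_eq)
  then have "of_int i = of_nat (CARD('p) ^ n) * embed u"
    by (simp add: of_nat_P field_simps del: of_nat_power)
  then have "embed (of_int i) = embed (of_nat (CARD('p) ^ n) * u)"
    by (simp only: embed_mult embed_of_nat embed_of_int)
  then have "(of_int i :: 'p padic_int) = of_nat (CARD('p) ^ n) * u" by (simp only: embed_eq_iff)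
  then have "Rep_padic_int (of_int i :: 'p padic_int) n
      = Rep_padic_int (of_nat (CARD('p) ^ n) * u) n" by simp
  then have "i mod int CARD('p) ^ n = 0"
    by (simp only: Rep_padic_int_of_int times_padic_int.rep_eq Rep_padic_int_of_nat) simp
  then show ?thesis by auto
qed

lemma R_decompose:
  assumes "x \<in> R" "x \<noteq> 0"
  obtains n w where "x = P ^ n * w" "w \<in> R" "1 / w \<in> R"
proof -
  obtain u where u: "x = embed u" using assms by (auto simp: R_eq)
  have "u \<noteq> 0" using assms(2) embed_of_int[of 0] by (auto simp: u)
  then obtain n w w' where w: "u = of_nat (CARD('p) ^ n) * w" "w * w' = 1"
    by (rule padic_int_decompose)
  have "x = P ^ n * embed w" unfolding u w(1) embed_mult embed_of_nat of_nat_P by simp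
  moreover have "embed w * embed w' = 1"
    using w(2) embed_of_int[of 1] by (simp flip: embed_mult)
  then have "1 / embed w = embed w'" by (metis div_by_0 eq_divide_imp mult.commute mult_zero_left zero_neq_one)
  ultimately show ?thesis using that[of n "embed w"] by (auto simp: R_eq)
qed

lemma K_decompose:
  assumes "x \<in> K" "x \<noteq> 0"
  obtains k w where "x = P powi k * w" "w \<in> R" "1 / w \<in> R"
proof -
  obtain y where y: "\<iota> x = to_ac y" using assms(1) by (rule K_E)
  obtain u v where uv: "y = Fract u v" "v \<noteq> 0" by (cases y)
  have "Fract u v = Fract u 1 / Fract v 1" using uv by simp
  then have "\<iota> x = \<iota> (embed u / embed v)" by (simp add: y uv iota_simps iota_embed flip: to_ac_divide)
  then have x: "x = embed u / embed v" using iota_simps(11) by blast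
  then have "embed u \<noteq> 0" "embed v \<noteq> 0" using assms(2) by auto
  moreover have "embed u \<in> R" "embed v \<in> R" by (auto simp: R_eq)
  ultimately obtain n w m w' where
    "embed u = P ^ n * w" "w \<in> R" "1 / w \<in> R" "embed v = P ^ m * w'" "w' \<in> R" "1 / w' \<in> R"
    by (metis R_decompose)
  moreover from this have "x = P powi (int n - int m) * (w / w')"
    by (simp add: x power_int_diff)
  moreover have "w / w' \<in> R" using calculation R_mult[of w "1 / w'"] by simp
  moreover have "1 / (w / w') \<in> R" using calculation R_mult[of "1 / w" w'] by simp
  ultimately show ?thesis using that by blast
qed

lemma inverse_P_notin_R: "1 / P \<notin> R"
proof
  assume "1 / P \<in> R"
  then have "int CARD('p) dvd 1" using R_int_dvd[of 1 1] by simp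
  then show False using CARD_prime_int[where 'p = 'p] not_prime_unit by blast
qed

text \<open>
  The factor \<open>P\<close> records that the inverse of a p-adic number which is not integral lies even in the
  maximal ideal.
\<close>

lemma R_valuation_ring:
  assumes "x \<in> K" "x \<notin> R"
  shows "1 / (P * x) \<in> R"
proof -
  have "x \<noteq> 0" using assms(2) by auto
  then obtain k w where x: "x = P powi k * w" "w \<in> R" "1 / w \<in> R" by (rule K_decompose[OF assms(1)])
  have "k < 0"
  proof (rule ccontr)
    assume "\<not> k < 0"
    then have "P powi k = P ^ nat k" by (simp add: power_int_def)
    then show False using assms(2) x R_mult R_power R_of_nat by simp
  qed
  then have "P powi k * P * P ^ nat (- k - 1) = 1"
    by (simp add: power_int_def field_simps flip: power_Suc)
      (simp add: Suc_nat_eq_nat_zadd1)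
  then have "1 / (P * x) = P ^ nat (- k - 1) * (1 / w)"
    using \<open>x \<noteq> 0\<close> by (simp add: x(1) field_simps)
  moreover have "P ^ nat (- k - 1) * (1 / w) \<in> R" using x(3) by (intro R_mult R_power R_P)
  ultimately show ?thesis by simp
qed

text \<open>
  The p-adic valuation, normalised by \<open>ord P = 1\<close>; it is meaningful for non-zero p-adic numbers only.
\<close>

definition ord :: "complex \<Rightarrow> int" where
  "ord x = (THE k. x / P powi k \<in> R \<and> P powi k / x \<in> R)"

lemma ord_unique_aux:
  assumes "x / P powi k \<in> R" "P powi l / x \<in> R" "x \<noteq> 0"
  shows "k \<le> l"
proof (rule ccontr)
  assume "\<not> k \<le> l"
  then have "P powi (k - l) = P ^ Suc (nat (k - l - 1))"
    by (simp add: power_int_def Suc_nat_eq_nat_zadd1)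
  then have "P powi k = P powi l * (P * P ^ nat (k - l - 1))"
    by (simp add: power_int_diff field_simps)
  then have "1 / P = (x / P powi k) * (P powi l / x) * P ^ nat (k - l - 1)"
    using assms(3) by (simp add: field_simps)
  moreover have "\<dots> \<in> R" using assms by (intro R_mult R_power) auto
  ultimately show False using inverse_P_notin_R by simp
qed

lemma ord_eqI:
  assumes "x / P powi k \<in> R" "P powi k / x \<in> R" "x \<noteq> 0"
  shows "ord x = k"
  unfolding ord_def using assms ord_unique_aux by (intro the_equality) (auto intro: antisym)

lemma ord_R:
  assumes "x \<in> K" "x \<noteq> 0"
  shows "x / P powi ord x \<in> R" "P powi ord x / x \<in> R"
proof -
  obtain k w where x: "x = P powi k * w" "w \<in> R" "1 / w \<in> R" by (rule K_decompose[OF assms])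
  then have "x / P powi k \<in> R" "P powi k / x \<in> R" by simp_all
  moreover from this have "ord x = k" using assms(2) by (intro ord_eqI)
  ultimately show "x / P powi ord x \<in> R" "P powi ord x / x \<in> R" by simp_all
qed

lemma ord_mult:
  assumes "x \<in> K" "x \<noteq> 0" "y \<in> K" "y \<noteq> 0"
  shows "ord (x * y) = ord x + ord y"
proof (rule ord_eqI)
  show "x * y / P powi (ord x + ord y) \<in> R"
    using R_mult[OF ord_R(1)[OF assms(1,2)] ord_R(1)[OF assms(3,4)]] by (simp add: power_int_add)
  show "P powi (ord x + ord y) / (x * y) \<in> R"
    using R_mult[OF ord_R(2)[OF assms(1,2)] ord_R(2)[OF assms(3,4)]] by (simp add: power_int_add)
qed (use assms in simp)

lemma ord_one: "ord 1 = 0"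
  by (rule ord_eqI) simp_all

end

section \<open>Integral quadratic equations of a given discriminant\<close>

text \<open>
  Equations with a common factor are admitted, because the p-adic reduction can produce one from a
  primitive equation, and dividing the factor out would change the discriminant.
\<close>

definition quad_root :: "int \<Rightarrow> complex \<Rightarrow> bool" where
  "quad_root D x \<longleftrightarrow> (\<exists>A B C :: int. of_int A * x ^ 2 + of_int B * x + of_int C = 0 \<and>
     B ^ 2 - 4 * A * C = D)"

lemma quad_rootI:
  "of_int A * x ^ 2 + of_int B * x + of_int C = 0 \<Longrightarrow> B ^ 2 - 4 * A * C = D \<Longrightarrow> quad_root D x"
  unfolding quad_root_def by blast

lemma quad_root_translate:
  assumes "quad_root D x"
  shows "quad_root D (x - of_int b)"
proof -
  obtain A B C where *: "of_int A * x ^ 2 + of_int B * x + of_int C = 0" "B ^ 2 - 4 * A * C = D"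
    using assms by (auto simp: quad_root_def)
  show ?thesis
  proof (rule quad_rootI)
    show "of_int A * (x - of_int b) ^ 2 + of_int (2 * A * b + B) * (x - of_int b)
        + of_int (A * b ^ 2 + B * b + C) = 0"
      using *(1) by (simp add: algebra_simps power2_eq_square)
    show "(2 * A * b + B) ^ 2 - 4 * A * (A * b ^ 2 + B * b + C) = D"
      unfolding *(2)[symmetric] by (simp add: algebra_simps power2_eq_square)
  qed
qed

lemma quad_root_neg_inverse:
  assumes "quad_root D x" "x \<noteq> 0"
  shows "quad_root D (- 1 / x)"
proof -
  obtain A B C where *: "of_int A * x ^ 2 + of_int B * x + of_int C = 0" "B ^ 2 - 4 * A * C = D"
    using assms by (auto simp: quad_root_def)
  show ?thesis
  proof (rule quad_rootI)
    have "of_int C * (- 1 / x) ^ 2 + of_int (- B) * (- 1 / x) + of_int A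
        = (of_int A * x ^ 2 + of_int B * x + of_int C) / x ^ 2"
      using assms(2) by (simp add: field_simps power2_eq_square)
    then show "of_int C * (- 1 / x) ^ 2 + of_int (- B) * (- 1 / x) + of_int A = 0"
      using *(1) by simp
    show "(- B) ^ 2 - 4 * C * A = D" using *(2) by (simp add: algebra_simps)
  qed
qed

lemma quad_root_coordinates:
  assumes "quad_root D x" "D < 0" "Im x > 0"
  obtains A B C :: int where "A \<noteq> 0" "2 * real_of_int A * Re x = - real_of_int B"
    "(2 * real_of_int A * Im x) ^ 2 = - real_of_int D" "B ^ 2 - 4 * A * C = D"
proof -
  obtain A B C where *: "of_int A * x ^ 2 + of_int B * x + of_int C = 0" "B ^ 2 - 4 * A * C = D"
    using assms by (auto simp: quad_root_def)
  \<comment> \<open>The imaginary and the real part of the equation determine the vertex and the height of the root.\<close>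
  have "Im x * (2 * real_of_int A * Re x + real_of_int B) = 0"
    using arg_cong[OF *(1), of Im] by (simp add: power2_eq_square algebra_simps)
  then have B: "2 * real_of_int A * Re x = - real_of_int B" using assms(3) by auto
  have re: "real_of_int A * (Re x ^ 2 - Im x ^ 2) + real_of_int B * Re x + real_of_int C = 0"
    using arg_cong[OF *(1), of Re] by (simp add: power2_eq_square algebra_simps)
  have D: "real_of_int D = real_of_int B ^ 2 - 4 * real_of_int A * real_of_int C"
    using *(2) by (metis of_int_diff of_int_mult of_int_numeral of_int_power)
  have "(2 * real_of_int A * Im x) ^ 2 = (2 * real_of_int A * Re x) ^ 2
      + 2 * (2 * real_of_int A * Re x) * real_of_int B + 4 * real_of_int A * real_of_int C
      - 4 * real_of_int A
        * (real_of_int A * (Re x ^ 2 - Im x ^ 2) + real_of_int B * Re x + real_of_int C)"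
    by (simp only: power2_eq_square ring_distribs) simp
  also have "\<dots> = - real_of_int D" unfolding B D re by (simp add: power2_eq_square)
  finally have im: "(2 * real_of_int A * Im x) ^ 2 = - real_of_int D" .
  have "A \<noteq> 0"
  proof
    assume "A = 0"
    then show False using im assms(2) by simp
  qed
  then show ?thesis using that B im *(2) by blast
qed

section \<open>The fundamental domain\<close>

lemma fund_dom_bounds:
  assumes "z \<in> fund_dom"
  shows "Im z > 0" "1 \<le> cmod z" "- 1 / 2 \<le> Re z" "Re z < 1 / 2"
proof -
  have "Im z > 0 \<and> 1 \<le> cmod z \<and> - 1 / 2 \<le> Re z \<and> Re z < 1 / 2"
  proof (cases "z \<in> cis ` {pi / 2..2 * pi / 3}")
    case True
    then obtain t where t: "pi / 2 \<le> t" "t \<le> 2 * pi / 3" "z = cis t" by auto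
    have "cos (2 * pi / 3) \<le> cos t" "cos t \<le> cos (pi / 2)"
      using t pi_gt_zero by (auto intro!: cos_monotone_0_pi_le simp del: cos_pi_half)
    moreover have "0 < t" "t < pi" using t(1,2) pi_gt_zero by linarith+
    then have "sin t > 0" by (rule sin_gt_zero)
    ultimately show ?thesis using t(3) by (simp add: cos_120)
  qed (use assms in \<open>auto simp: fund_dom_def\<close>)
  then show "Im z > 0" "1 \<le> cmod z" "- 1 / 2 \<le> Re z" "Re z < 1 / 2" by auto
qed

text \<open>
  Since \<open>\<bar>z\<bar> \<ge> 1\<close> and \<open>\<bar>2 Re z\<bar> \<le> 1\<close>, the square of the absolute value is at least
  \<open>g\<^sup>2 - \<bar>g h\<bar> + h\<^sup>2\<close>, a positive integer.
\<close>

lemma fund_dom_form_ge_1: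
  fixes g h :: int
  assumes "z \<in> fund_dom" "g \<noteq> 0 \<or> h \<noteq> 0"
  shows "1 \<le> cmod (of_int g * z + of_int h)"
proof -
  have "1 \<le> Re z ^ 2 + Im z ^ 2"
    using fund_dom_bounds(2)[OF assms(1)] by (simp add: cmod_def)
  then have "real_of_int g ^ 2 * 1 \<le> real_of_int g ^ 2 * (Re z ^ 2 + Im z ^ 2)"
    by (intro mult_left_mono) auto
  moreover have "\<bar>2 * Re z\<bar> \<le> 1" using fund_dom_bounds(3,4)[OF assms(1)] by (auto simp: abs_le_iff)
  then have "\<bar>real_of_int g * real_of_int h\<bar> * \<bar>2 * Re z\<bar> \<le> \<bar>real_of_int g * real_of_int h\<bar> * 1"
    by (intro mult_left_mono) auto
  then have "- \<bar>real_of_int g * real_of_int h\<bar> \<le> real_of_int g * real_of_int h * (2 * Re z)"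
    by (simp add: abs_mult[symmetric])
  moreover have "(cmod (of_int g * z + of_int h)) ^ 2 = real_of_int g ^ 2 * (Re z ^ 2 + Im z ^ 2)
      + real_of_int g * real_of_int h * (2 * Re z) + real_of_int h ^ 2"
    by (simp only: cmod_power2) (simp add: power2_eq_square algebra_simps)
  moreover have "1 \<le> real_of_int g ^ 2 - \<bar>real_of_int g * real_of_int h\<bar> + real_of_int h ^ 2"
  proof -
    have "g ^ 2 + h ^ 2 - \<bar>g * h\<bar> > 0"
    proof -
      have "2 * \<bar>g * h\<bar> \<le> g ^ 2 + h ^ 2"
        using zero_le_power2[of "\<bar>g\<bar> - \<bar>h\<bar>"] by (simp add: power2_diff abs_mult)
      moreover have "g ^ 2 + h ^ 2 > 0" using assms(2) by (simp add: sum_power2_gt_zero_iff)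
      moreover have "0 \<le> \<bar>g * h\<bar>" by simp
      ultimately show ?thesis by linarith
    qed
    then have "1 \<le> g ^ 2 + h ^ 2 - \<bar>g * h\<bar>" by simp
    then have "real_of_int 1 \<le> real_of_int (g ^ 2 + h ^ 2 - \<bar>g * h\<bar>)"
      by (simp only: of_int_le_iff)
    then show ?thesis by simp
  qed
  ultimately have "1 ^ 2 \<le> (cmod (of_int g * z + of_int h)) ^ 2" by simp
  then show ?thesis by (rule power2_le_imp_le) simp
qed

text \<open>
  In the fundamental domain \<open>(Im x)\<^sup>2 \<ge> 3 / 4\<close> bounds the leading coefficient \<open>A\<close> in terms of \<open>D\<close>, and
  \<open>\<bar>Re x\<bar> \<le> 1 / 2\<close> bounds the middle coefficient \<open>B\<close> in terms of \<open>A\<close>.  The root is determined by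
  \<open>A\<close>, \<open>B\<close> and \<open>D\<close>.
\<close>

lemma finite_fund_dom_quad_root:
  assumes "D < 0"
  shows "finite {x \<in> fund_dom. quad_root D x}"
proof -
  let ?f = "\<lambda>(A :: int, B :: int).
    Complex (- real_of_int B / (2 * real_of_int A)) (sqrt (- real_of_int D) / (2 * \<bar>real_of_int A\<bar>))"
  have "{x \<in> fund_dom. quad_root D x} \<subseteq> ?f ` ({D..- D} \<times> {D..- D})"
  proof safe
    fix x assume x: "x \<in> fund_dom" "quad_root D x"
    note b = fund_dom_bounds[OF x(1)]
    obtain A B C :: int where A: "A \<noteq> 0" "2 * real_of_int A * Re x = - real_of_int B"
        "(2 * real_of_int A * Im x) ^ 2 = - real_of_int D"
      using quad_root_coordinates[OF x(2) assms b(1)] by metis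
    have "\<bar>Re x\<bar> \<le> 1 / 2" using b by auto
    then have re: "Re x ^ 2 \<le> 1 / 4" using power_mono[of "\<bar>Re x\<bar>" "1/2" 2]
      by (simp add: power2_eq_square)
    have "1 \<le> Re x ^ 2 + Im x ^ 2" using b(2) by (simp add: cmod_def)
    then have "3 / 4 \<le> Im x ^ 2" using re by simp
    then have "4 * real_of_int A ^ 2 * (3 / 4) \<le> 4 * real_of_int A ^ 2 * Im x ^ 2"
      by (intro mult_left_mono) auto
    then have "3 * real_of_int A ^ 2 \<le> - real_of_int D" using A(3) by (simp add: power_mult_distrib)
    then have "real_of_int (3 * A ^ 2) \<le> real_of_int (- D)" by simp
    then have "3 * A ^ 2 \<le> - D" by (simp only: of_int_le_iff)
    moreover have "\<bar>A\<bar> \<le> A ^ 2"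
      using A(1) self_le_power[of "\<bar>A\<bar>" 2] by simp
    ultimately have absA: "\<bar>A\<bar> \<le> - D" by linarith
    have "\<bar>real_of_int B\<bar> = \<bar>real_of_int A\<bar> * \<bar>2 * Re x\<bar>"
      using A(2) by (simp add: abs_mult[symmetric])
    also have "\<dots> \<le> \<bar>real_of_int A\<bar> * 1" using \<open>\<bar>Re x\<bar> \<le> 1 / 2\<close> by (intro mult_left_mono) auto
    finally have "\<bar>B\<bar> \<le> \<bar>A\<bar>" by linarith
    then have "(A, B) \<in> {D..- D} \<times> {D..- D}" using absA by auto
    moreover have "sqrt (- real_of_int D) = \<bar>2 * real_of_int A * Im x\<bar>"
      using A(3) by (metis real_sqrt_abs)
    then have "x = ?f (A, B)"
      using A b(1) by (simp add: complex_eq_iff abs_mult field_simps)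
    ultimately show "x \<in> ?f ` ({D..- D} \<times> {D..- D})" by (rule rev_image_eqI)
  qed
  then show ?thesis by (rule finite_subset) simp
qed

section \<open>One step of the algorithm\<close>

context padic_identification
begin

text \<open>
  The value \<open>f\<close> of the quadratic polynomial at \<open>a\<close> contains the factor \<open>a - x\<close>, hence is divisible by
  \<open>p\<^sup>2\<close> as a p-adic integer and therefore as an integer.
\<close>

lemma quad_root_padic_reduction:
  assumes "quad_root D x" "x \<in> R" "(x - of_nat a) / P ^ 2 \<in> R"
  shows "quad_root D ((x - of_nat a) / P ^ 2)"
proof -
  obtain A B C where *: "of_int A * x ^ 2 + of_int B * x + of_int C = 0" "B ^ 2 - 4 * A * C = D"
    using assms by (auto simp: quad_root_def)
  define y where "y = (x - of_nat a) / P ^ 2"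
  have x: "x = P ^ 2 * y + of_nat a" by (simp add: y_def)
  define f where "f = A * int a ^ 2 + B * int a + C"
  \<comment> \<open>Subtract the value at the root, which is zero, to exhibit the factor.\<close>
  have "of_int f = (of_int f :: complex) - (of_int A * x ^ 2 + of_int B * x + of_int C)"
    using *(1) by simp
  also have "\<dots> = - (P ^ 2 * y) * (of_int A * (x + of_nat a) + of_int B)"
    unfolding x f_def by (simp add: power2_eq_square algebra_simps)
  finally have "of_int f / P ^ 2 = (- y) * (of_int A * (x + of_nat a) + of_int B)"
    by (simp add: field_simps)
  moreover have "\<dots> \<in> R"
    using assms(2,3) by (intro R_mult R_uminus R_add R_of_int R_of_nat) (simp_all add: y_def)
  ultimately have "int CARD('p) ^ 2 dvd f" by (intro R_int_dvd) simp
  then obtain f' where f': "f = int CARD('p) ^ 2 * f'" by (rule dvdE)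
  have P: "P = of_int (int CARD('p))" by (simp add: P_def)
  have "quad_root D y"
  proof (rule quad_rootI)
    have "of_int (A * int CARD('p) ^ 2) * y ^ 2 + of_int (2 * A * int a + B) * y + of_int f'
        = (of_int A * (P ^ 2 * y) ^ 2 + of_int (2 * A * int a + B) * (P ^ 2 * y) + of_int f) / P ^ 2"
      by (simp add: f' P_def field_simps power2_eq_square)
    also have "\<dots> = (of_int A * x ^ 2 + of_int B * x + of_int C) / P ^ 2"
      unfolding x f_def by (simp add: algebra_simps power2_eq_square)
    finally show "of_int (A * int CARD('p) ^ 2) * y ^ 2 + of_int (2 * A * int a + B) * y
        + of_int f' = 0" using *(1) by simp
    have "(2 * A * int a + B) ^ 2 - 4 * (A * int CARD('p) ^ 2) * f'
        = (2 * A * int a + B) ^ 2 - 4 * A * f" by (simp add: f')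
    also have "\<dots> = D" unfolding f_def *(2)[symmetric] by (simp add: algebra_simps power2_eq_square)
    finally show "(2 * A * int a + B) ^ 2 - 4 * (A * int CARD('p) ^ 2) * f' = D" .
  qed
  then show ?thesis by (simp add: y_def)
qed

lemma cf_init_in_R:
  assumes "x \<in> K"
  shows "cf_init \<iota> x \<in> R"
proof (cases "x \<in> R")
  case False
  then have "x \<noteq> 0" by auto
  have "- 1 / x = - (P * (1 / (P * x)))" using \<open>x \<noteq> 0\<close> by simp
  also have "\<dots> \<in> R" using R_valuation_ring[OF assms False] by (intro R_uminus R_mult R_P)
  finally show ?thesis using False by (simp add: cf_init_def cf_delta_def)
qed (simp add: cf_init_def cf_delta_def)

lemma cf_a_residue:
  assumes "x \<in> K"
  shows "(cf_init \<iota> x - of_nat (cf_a \<iota> x)) / P ^ 2 \<in> R"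
proof -
  let ?Q = "\<lambda>a. a < CARD('p) ^ 2 \<and>
     (\<exists>u \<in> R. cf_init \<iota> x - of_nat a = of_nat (CARD('p) ^ 2) * u)"
  obtain a where a: "a < CARD('p) ^ 2" "(cf_init \<iota> x - of_nat a) / P ^ 2 \<in> R"
    using R_residue[OF cf_init_in_R[OF assms]] .
  have iff: "?Q b \<longleftrightarrow> b < CARD('p) ^ 2 \<and> (cf_init \<iota> x - of_nat b) / P ^ 2 \<in> R" for b
  proof -
    have "(\<exists>u \<in> R. cf_init \<iota> x - of_nat b = P ^ 2 * u)
        \<longleftrightarrow> (\<exists>u \<in> R. (cf_init \<iota> x - of_nat b) / P ^ 2 = u)"
      by (simp add: divide_eq_eq mult.commute)
    then show ?thesis unfolding of_nat_P by simp
  qed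
  have "?Q (THE b. ?Q b)"
  proof (rule theI')
    show "\<exists>!b. ?Q b"
    proof (rule ex1I)
      show "?Q a" using a iff by blast
      fix b assume "?Q b"
      then have b: "b < CARD('p) ^ 2" "(cf_init \<iota> x - of_nat b) / P ^ 2 \<in> R" using iff by blast+
      have "of_int (int a - int b) / P ^ 2
          = (cf_init \<iota> x - of_nat b) / P ^ 2 - (cf_init \<iota> x - of_nat a) / P ^ 2"
        by (simp add: diff_divide_distrib)
      then have "int CARD('p) ^ 2 dvd int a - int b"
        using R_diff[OF b(2) a(2)] by (intro R_int_dvd) simp
      then have "int a mod int (CARD('p) ^ 2) = int b mod int (CARD('p) ^ 2)"
        by (simp add: mod_eq_dvd_iff)
      then show "b = a" using a(1) b(1) by (metis mod_less of_nat_eq_iff zmod_int)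
    qed
  qed
  then have "?Q (cf_a \<iota> x)" unfolding cf_a_def .
  then show ?thesis using iff by blast
qed

lemma cf_z0_eq: "cf_z0 \<iota> x = (cf_init \<iota> x - of_nat (cf_a \<iota> x)) / P ^ 2"
  by (simp only: cf_z0_def of_nat_P)

lemma cf_z0_in_R: "x \<in> K \<Longrightarrow> cf_z0 \<iota> x \<in> R"
  unfolding cf_z0_eq by (rule cf_a_residue)

text \<open>
  The numbers on which the algorithm operates; every step leads from this set to itself, with the
  same discriminant.
\<close>

definition complete_quotient :: "int \<Rightarrow> complex \<Rightarrow> bool" where
  "complete_quotient D x \<longleftrightarrow> Im x > 0 \<and> x \<in> K \<and> quad_root D x"

lemma complete_quotient_neg_inverse:
  assumes "complete_quotient D x"
  shows "complete_quotient D (- 1 / x)"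
proof -
  have "x \<noteq> 0" using assms by (auto simp: complete_quotient_def)
  then show ?thesis
    using assms half_plane_inverse[of x] quad_root_neg_inverse[of D x] K_divide[of "of_int (- 1)" x]
      K_of_int[of "- 1"] by (simp add: complete_quotient_def)
qed

lemma complete_quotient_inf_step:
  assumes "complete_quotient D x"
  shows "complete_quotient D (inf_step x)"
proof -
  have "complete_quotient D (x - of_int (inf_digit x))"
    using assms quad_root_translate by (auto simp: complete_quotient_def K_diff)
  then show ?thesis unfolding inf_step_def by (rule complete_quotient_neg_inverse)
qed

lemma complete_quotient_cf_init:
  "complete_quotient D x \<Longrightarrow> complete_quotient D (cf_init \<iota> x)"
  using complete_quotient_neg_inverse by (simp add: cf_init_def)

lemma complete_quotient_cf_z0:
  assumes "complete_quotient D x"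
  shows "complete_quotient D (cf_z0 \<iota> x)"
proof -
  have *: "complete_quotient D (cf_init \<iota> x)" by (rule complete_quotient_cf_init[OF assms])
  have x: "x \<in> K" using assms by (simp add: complete_quotient_def)
  have "cf_z0 \<iota> x = (cf_init \<iota> x - of_nat (cf_a \<iota> x)) / of_real (real CARD('p) ^ 2)"
    by (simp add: cf_z0_def)
  then have "Im (cf_z0 \<iota> x) = Im (cf_init \<iota> x) / real CARD('p) ^ 2"
    by (simp only: Im_divide_of_real) simp
  then have "Im (cf_z0 \<iota> x) > 0" using * CARD_pos[where 'p = 'p] by (simp add: complete_quotient_def)
  moreover have "quad_root D (cf_z0 \<iota> x)"
    unfolding cf_z0_eq using * cf_init_in_R[OF x] cf_a_residue[OF x]
    by (intro quad_root_padic_reduction) (auto simp: complete_quotient_def)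
  ultimately show ?thesis using cf_z0_in_R[OF x] R_subset_K by (simp add: complete_quotient_def)
qed

lemma complete_quotient_inf_iterate:
  "complete_quotient D x \<Longrightarrow> complete_quotient D ((inf_step ^^ j) x)"
  by (induction j) (auto intro: complete_quotient_inf_step)

lemma complete_quotient_cf_next:
  "complete_quotient D x \<Longrightarrow> complete_quotient D (cf_next \<iota> x)"
  unfolding cf_next_def by (intro complete_quotient_inf_iterate complete_quotient_cf_z0)

lemma complete_quotient_iterate:
  "complete_quotient D x \<Longrightarrow> complete_quotient D ((cf_next \<iota> ^^ n) x)"
  by (induction n) (auto intro: complete_quotient_cf_next)

lemma cf_next_in_fund_dom: "inf_ends (cf_z0 \<iota> x) \<Longrightarrow> cf_next \<iota> x \<in> fund_dom"
  unfolding inf_ends_def cf_next_def inf_length_def by (rule LeastI_ex)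

lemma cf_iterate_in_fund_dom:
  assumes "cf_defined \<iota> z" "n > 0"
  shows "(cf_next \<iota> ^^ n) z \<in> fund_dom"
proof -
  obtain m where m: "n = Suc m" using assms(2) gr0_conv_Suc by blast
  have "inf_ends (cf_z0 \<iota> (cf_x \<iota> z (Suc m)))" using assms(1) by (simp add: cf_defined_def)
  then show ?thesis using cf_next_in_fund_dom by (simp add: m cf_x_def)
qed

text \<open>
  All iterates from the first one on lie in a finite set.
\<close>

lemma cf_iterate_repeats:
  assumes "complete_quotient D z" "D < 0" "cf_defined \<iota> z"
  obtains m n where "m < n" "(cf_next \<iota> ^^ m) z = (cf_next \<iota> ^^ n) z"
proof -
  let ?f = "\<lambda>n. (cf_next \<iota> ^^ Suc n) z"
  have "range ?f \<subseteq> {x \<in> fund_dom. quad_root D x}"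
    using cf_iterate_in_fund_dom[OF assms(3), of "Suc _"] complete_quotient_iterate[OF assms(1), of "Suc _"]
    by (auto simp: complete_quotient_def simp del: funpow.simps)
  then have "finite (range ?f)" using finite_fund_dom_quad_root[OF assms(2)] finite_subset by blast
  then have "\<not> inj ?f" using range_inj_infinite by blast
  then obtain m n where "m \<noteq> n" "?f m = ?f n" by (auto simp: inj_def)
  then show ?thesis using that[of "Suc m" "Suc n"] that[of "Suc n" "Suc m"]
    by (metis Suc_less_eq nat_neq_iff)
qed

end

section \<open>The step matrices and their action on lattices\<close>

text \<open>
  Homogeneous coordinates keep the automorphy factor \<open>row2 M z 1\<close>, which is where the units come from.
\<close>

definition row1 :: "rat^2^2 \<Rightarrow> complex \<Rightarrow> complex \<Rightarrow> complex" where
  "row1 M u v = of_rat (M $ 1 $ 1) * u + of_rat (M $ 1 $ 2) * v"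

definition row2 :: "rat^2^2 \<Rightarrow> complex \<Rightarrow> complex \<Rightarrow> complex" where
  "row2 M u v = of_rat (M $ 2 $ 1) * u + of_rat (M $ 2 $ 2) * v"

lemmas row_defs = row1_def row2_def

lemma matrix_mult_2: "((M :: 'a::semiring_1^2^2) ** N) $ i $ j = M $ i $ 1 * N $ 1 $ j + M $ i $ 2 * N $ 2 $ j"
  by (simp add: matrix_matrix_mult_def sum_2)

lemma mat_1_2 [simp]:
  "(mat 1 :: rat^2^2) $ 1 $ 1 = 1" "(mat 1 :: rat^2^2) $ 1 $ 2 = 0"
  "(mat 1 :: rat^2^2) $ 2 $ 1 = 0" "(mat 1 :: rat^2^2) $ 2 $ 2 = 1"
  by (simp_all add: mat_def)

lemma row_mult:
  "row1 (M ** N) u v = row1 M (row1 N u v) (row2 N u v)"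
  "row2 (M ** N) u v = row2 M (row1 N u v) (row2 N u v)"
  by (simp_all add: row_defs matrix_mult_2 of_rat_add of_rat_mult algebra_simps)

lemma row_mat_1 [simp]: "row1 (mat 1) u v = u" "row2 (mat 1) u v = v"
  by (simp_all add: row_defs)

lemma cnj_of_rat [simp]: "cnj (of_rat q) = of_rat q"
proof (cases q)
  case (Fract a b)
  then show ?thesis by (simp add: Fract_of_int_quotient of_rat_divide)
qed

lemma row_cnj: "row1 M (cnj u) (cnj v) = cnj (row1 M u v)" "row2 M (cnj u) (cnj v) = cnj (row2 M u v)"
  by (simp_all add: row_defs)

lemma row_det:
  "row1 M u v * row2 M u' v' - row1 M u' v' * row2 M u v = of_rat (det M) * (u * v' - u' * v)"
  by (simp add: row_defs det_2 of_rat_mult of_rat_diff algebra_simps)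

definition integral_matrix :: "rat^2^2 \<Rightarrow> bool" where
  "integral_matrix M \<longleftrightarrow> (\<forall>i j. M $ i $ j \<in> \<int>)"

lemma integral_matrix_mult: "integral_matrix M \<Longrightarrow> integral_matrix N \<Longrightarrow> integral_matrix (M ** N)"
  by (simp add: integral_matrix_def matrix_mult_2)

lemma integral_multiple_mult:
  fixes M N :: "rat^2^2"
  assumes "\<And>i j. c * M $ i $ j \<in> \<int>" "integral_matrix N"
  shows "c * (M ** N) $ i $ j \<in> \<int>" "c * (N ** M) $ i $ j \<in> \<int>"
proof -
  have N: "N $ k $ l \<in> \<int>" for k l using assms(2) by (simp add: integral_matrix_def)
  have "(c * M $ i $ 1) * N $ 1 $ j + (c * M $ i $ 2) * N $ 2 $ j \<in> \<int>"
    "N $ i $ 1 * (c * M $ 1 $ j) + N $ i $ 2 * (c * M $ 2 $ j) \<in> \<int>"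
    by (intro Ints_add Ints_mult N assms(1))+
  then show "c * (M ** N) $ i $ j \<in> \<int>" "c * (N ** M) $ i $ j \<in> \<int>"
    by (simp_all add: matrix_mult_2 algebra_simps)
qed

text \<open>
  \<open>M\<close> acts on \<open>x\<close> by a linear fractional transformation with value \<open>y\<close>, stated without denominators so
  that it composes without side conditions.
\<close>

definition sends :: "rat^2^2 \<Rightarrow> complex \<Rightarrow> complex \<Rightarrow> bool" where
  "sends M x y \<longleftrightarrow> (\<forall>v. row1 M (x * v) v = y * row2 M (x * v) v)"

lemma sends_mult: "sends M x y \<Longrightarrow> sends N y w \<Longrightarrow> sends (N ** M) x w"
  by (simp add: sends_def row_mult)

lemma sends_mat_1: "sends (mat 1) x x"
  by (simp add: sends_def)

lemma integral_inf_matrix: "integral_matrix (inf_matrix z j)"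
proof (induction j)
  case (Suc j)
  have "integral_matrix (vector [vector [0, - 1], vector [1, - of_int b]])" for b
    by (simp add: integral_matrix_def forall_2 vector_2)
  then show ?case using integral_matrix_mult[OF _ Suc] by simp
qed (simp add: integral_matrix_def mat_def)

lemma det_inf_matrix: "det (inf_matrix z j) = 1"
  by (induction j) (simp_all add: det_mul det_2[of "vector _"] vector_2)

lemma half_plane_inf_step:
  assumes "Im z > 0"
  shows "Im (inf_step z) > 0"
  using half_plane_inverse[of "z - of_int (inf_digit z)"] assms by (simp add: inf_step_def)

lemma half_plane_inf_iterate: "Im z > 0 \<Longrightarrow> Im ((inf_step ^^ j) z) > 0"
  by (induction j) (auto intro: half_plane_inf_step)

lemma sends_inf_matrix:
  assumes "Im z > 0"
  shows "sends (inf_matrix z j) z ((inf_step ^^ j) z)"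
proof (induction j)
  case (Suc j)
  let ?x = "(inf_step ^^ j) z"
  have "Im (?x - of_int (inf_digit ?x)) > 0" using half_plane_inf_iterate[OF assms, of j] by simp
  then have "?x - of_int (inf_digit ?x) \<noteq> 0" by (metis less_irrefl zero_complex.sel(2))
  then have "sends (vector [vector [0, - 1], vector [1, - of_int (inf_digit ?x)]]) ?x (inf_step ?x)"
    by (simp add: sends_def row_defs vector_2 inf_step_def of_rat_minus field_simps)
  then show ?case using sends_mult[OF Suc] by simp
qed (simp add: sends_mat_1)

definition p_fractions :: "nat \<Rightarrow> rat set" where
  "p_fractions p = {of_int m / of_nat p ^ n | m n. True}"

lemma p_fractionsI: "of_int m / of_nat p ^ n \<in> p_fractions p"
  by (auto simp: p_fractions_def)

lemma p_fractions_int [simp]: "of_int m \<in> p_fractions p"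
  using p_fractionsI[of m p 0] by simp

lemma p_fractions_0_1 [simp]: "0 \<in> p_fractions p" "1 \<in> p_fractions p"
  using p_fractions_int[of 0] p_fractions_int[of 1] by simp_all

lemma p_fractions_mult: "x \<in> p_fractions p \<Longrightarrow> y \<in> p_fractions p \<Longrightarrow> x * y \<in> p_fractions p"
proof -
  assume "x \<in> p_fractions p" "y \<in> p_fractions p"
  then obtain m n m' n' where "x = of_int m / of_nat p ^ n" "y = of_int m' / of_nat p ^ n'"
    by (auto simp: p_fractions_def)
  then have "x * y = of_int (m * m') / of_nat p ^ (n + n')" by (simp add: power_add)
  then show ?thesis using p_fractionsI by metis
qed

lemma p_fractions_add:
  assumes "p > 0" "x \<in> p_fractions p" "y \<in> p_fractions p"
  shows "x + y \<in> p_fractions p"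
proof -
  obtain m n m' n' where xy: "x = of_int m / of_nat p ^ n" "y = of_int m' / of_nat p ^ n'"
    using assms by (auto simp: p_fractions_def)
  have "x + y = of_int (m * int p ^ n' + m' * int p ^ n) / of_nat p ^ (n + n')"
    unfolding xy using assms(1) by (simp add: power_add add_frac_eq mult.commute)
  then show ?thesis using p_fractionsI by metis
qed

lemma p_fractions_uminus: "x \<in> p_fractions p \<Longrightarrow> - x \<in> p_fractions p"
  using p_fractions_mult[of "of_int (- 1)" p x] p_fractions_int[of "- 1" p] by simp

lemma p_fractions_diff: "p > 0 \<Longrightarrow> x \<in> p_fractions p \<Longrightarrow> y \<in> p_fractions p \<Longrightarrow> x - y \<in> p_fractions p"
  using p_fractions_add[of p x "- y"] p_fractions_uminus by simp

lemma matrix_inv_eqI: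
  fixes A B :: "'a::field^'n^'n"
  assumes "A ** B = mat 1"
  shows "matrix_inv A = B"
proof -
  have BA: "B ** A = mat 1" using assms by (simp add: matrix_left_right_inverse)
  have "A ** matrix_inv A = mat 1 \<and> matrix_inv A ** A = mat 1"
    unfolding matrix_inv_def by (rule someI[of _ B]) (use assms BA in blast)
  then have "matrix_inv A = B ** (A ** matrix_inv A)"
    by (metis BA matrix_mul_assoc matrix_mul_lid)
  also have "\<dots> = B" using \<open>A ** matrix_inv A = mat 1 \<and> _\<close> by simp
  finally show ?thesis .
qed

context padic_identification
begin

lemma p_pos: "CARD('p) > 0"
  using CARD_pos[where 'p = 'p] by simp

lemma p_fraction_in_R:
  assumes "q \<in> p_fractions CARD('p)" "of_rat q \<in> R"
  obtains i where "q = of_int i"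
proof -
  obtain m n where q: "q = of_int m / of_nat CARD('p) ^ n" using assms(1) by (auto simp: p_fractions_def)
  then have "of_rat q = of_int m / P ^ n" by (simp add: P_def of_rat_divide of_rat_power)
  then have "int CARD('p) ^ n dvd m" using assms(2) by (intro R_int_dvd) simp
  then obtain i where "m = int CARD('p) ^ n * i" by (rule dvdE)
  then show ?thesis using that[of i] q p_pos by simp
qed

lemma of_rat_Ints_in_R: "q \<in> \<int> \<Longrightarrow> of_rat q \<in> R"
  by (auto elim!: Ints_cases)

lemma integral_row_in_R:
  assumes "integral_matrix M" "u * c \<in> R" "v * c \<in> R"
  shows "row1 M u v * c \<in> R" "row2 M u v * c \<in> R"
proof -
  have "of_rat (M $ i $ j) \<in> R" for i j
    using assms(1) by (auto simp: integral_matrix_def intro: of_rat_Ints_in_R)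
  then have "of_rat (M $ i $ 1) * (u * c) + of_rat (M $ i $ 2) * (v * c) \<in> R" for i
    using R_add[OF R_mult[OF _ assms(2)] R_mult[OF _ assms(3)]] by blast
  then show "row1 M u v * c \<in> R" "row2 M u v * c \<in> R"
    by (simp_all add: row_defs algebra_simps)
qed

definition step_matrix :: "complex \<Rightarrow> rat^2^2" where
  "step_matrix x = cf_Q \<iota> x ** cf_P \<iota> x ** cf_D \<iota> x"

lemma integral_cf_D: "integral_matrix (cf_D \<iota> x)"
  by (simp add: integral_matrix_def forall_2 vector_2 cf_D_def mat_def)

lemma integral_cf_Q: "integral_matrix (cf_Q \<iota> x)"
  unfolding cf_Q_def by (rule integral_inf_matrix)

lemma cf_P_entries:
  "cf_P \<iota> x $ 1 $ 1 = 1 / of_nat CARD('p)" "cf_P \<iota> x $ 1 $ 2 = - of_nat (cf_a \<iota> x) / of_nat CARD('p)"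
  "cf_P \<iota> x $ 2 $ 1 = 0" "cf_P \<iota> x $ 2 $ 2 = of_nat CARD('p)"
  by (simp_all add: cf_P_def matrix_mult_2 vector_2)

lemma row_cf_P:
  "row1 (cf_P \<iota> x) u v = (u - of_nat (cf_a \<iota> x) * v) / P"
  "row2 (cf_P \<iota> x) u v = P * v"
  by (simp_all add: row_defs cf_P_entries P_def of_rat_divide of_rat_minus diff_divide_distrib)

lemma sends_cf_P: "sends (cf_P \<iota> x) (cf_init \<iota> x) (cf_z0 \<iota> x)"
  by (simp add: sends_def row_cf_P cf_z0_eq power2_eq_square field_simps)

lemma sends_cf_D:
  assumes "Im x > 0"
  shows "sends (cf_D \<iota> x) x (cf_init \<iota> x)"
proof -
  have "x \<noteq> 0" using assms by auto
  then show ?thesis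
    by (simp add: sends_def cf_D_def cf_init_def row_defs vector_2 of_rat_minus)
qed

lemma sends_step_matrix:
  assumes "complete_quotient D x"
  shows "sends (step_matrix x) x (cf_next \<iota> x)"
proof -
  have "Im x > 0" "Im (cf_z0 \<iota> x) > 0"
    using assms complete_quotient_cf_z0[OF assms] by (simp_all add: complete_quotient_def)
  then show ?thesis
    unfolding step_matrix_def cf_Q_def cf_next_def
    using sends_mult[OF sends_cf_D sends_mult[OF sends_cf_P sends_inf_matrix]]
    by (simp add: matrix_mul_assoc)
qed

lemma det_step_matrix: "det (step_matrix x) = 1"
  using p_pos
  by (simp add: step_matrix_def det_mul cf_Q_def det_inf_matrix det_2[of "cf_P \<iota> x"] cf_P_entries)
    (simp add: cf_D_def det_2 vector_2)

lemma step_matrix_entries: "of_nat CARD('p) * step_matrix x $ i $ j \<in> \<int>"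
proof -
  have "of_nat CARD('p) * cf_P \<iota> x $ k $ l \<in> \<int>" for k l
    using p_pos exhaust_2[of k] exhaust_2[of l] by (auto simp: cf_P_entries)
  then have *: "\<And>k l. of_nat CARD('p) * cf_P \<iota> x $ k $ l \<in> \<int>" .
  then have "\<And>k l. of_nat CARD('p) * (cf_P \<iota> x ** cf_D \<iota> x) $ k $ l \<in> \<int>"
    by (rule integral_multiple_mult(1)[OF _ integral_cf_D])
  then have "\<And>k l. of_nat CARD('p) * (cf_Q \<iota> x ** (cf_P \<iota> x ** cf_D \<iota> x)) $ k $ l \<in> \<int>"
    by (rule integral_multiple_mult(2)[OF _ integral_cf_Q])
  then show ?thesis by (simp add: step_matrix_def matrix_mul_assoc)
qed

lemma step_matrix_p_fractions: "step_matrix x $ i $ j \<in> p_fractions CARD('p)"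
proof -
  obtain m where "of_nat CARD('p) * step_matrix x $ i $ j = of_int m"
    using step_matrix_entries Ints_cases by metis
  then have "step_matrix x $ i $ j = of_int m / of_nat CARD('p) ^ 1"
    using p_pos by (simp add: field_simps)
  then show ?thesis using p_fractionsI by metis
qed

text \<open>
  Multiplied by \<open>p\<close>, a step matrix is integral.  Applied to conjugates, where nothing is known about the
  congruence defining the p-adic digit, this bounds the loss of order by one.
\<close>

lemma step_matrix_loses_one:
  assumes "u * c \<in> R" "v * c \<in> R"
  shows "row1 (step_matrix x) u v * (c * P) \<in> R" "row2 (step_matrix x) u v * (c * P) \<in> R"
proof -
  have "P * of_rat (step_matrix x $ i $ j) \<in> R" for i j
    using of_rat_Ints_in_R[OF step_matrix_entries[of x i j]] by (simp add: P_def of_rat_mult)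
  then have "P * of_rat (step_matrix x $ i $ 1) * (u * c) + P * of_rat (step_matrix x $ i $ 2) * (v * c) \<in> R" for i
    using R_add[OF R_mult[OF _ assms(1)] R_mult[OF _ assms(2)]] by blast
  then show "row1 (step_matrix x) u v * (c * P) \<in> R" "row2 (step_matrix x) u v * (c * P) \<in> R"
    by (simp_all add: row_defs algebra_simps)
qed

text \<open>
  For the complete quotient itself the order increases: after the p-adic reduction the vector is
  \<open>(z\<^sub>0 P v', P v')\<close> with a p-adic integer \<open>z\<^sub>0\<close>, and the other two factors of the step matrix are
  integral.
\<close>

lemma step_matrix_gains_one:
  assumes "complete_quotient D x" "x * v * c \<in> R" "v * c \<in> R"
  shows "row1 (step_matrix x) (x * v) v * (c / P) \<in> R" "row2 (step_matrix x) (x * v) v * (c / P) \<in> R"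
proof -
  have x: "Im x > 0" "x \<in> K" using assms(1) by (simp_all add: complete_quotient_def)
  define v' where "v' = row2 (cf_D \<iota> x) (x * v) v"
  have v'R: "v' * c \<in> R" unfolding v'_def by (rule integral_row_in_R[OF integral_cf_D assms(2,3)])
  have "row1 (cf_D \<iota> x) (x * v) v = cf_init \<iota> x * v'"
    using sends_cf_D[OF x(1)] by (simp add: sends_def v'_def)
  moreover have "row1 (cf_P \<iota> x) (cf_init \<iota> x * v') v' = cf_z0 \<iota> x * (P * v')"
    using sends_cf_P[of x] by (simp add: sends_def row_cf_P)
  ultimately have rows: "row1 (cf_P \<iota> x ** cf_D \<iota> x) (x * v) v = cf_z0 \<iota> x * (P * v')"
      "row2 (cf_P \<iota> x ** cf_D \<iota> x) (x * v) v = P * v'"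
    by (simp_all add: row_mult row_cf_P flip: v'_def)
  have "cf_z0 \<iota> x * (P * v') * (c / P) = cf_z0 \<iota> x * (v' * c)" "P * v' * (c / P) = v' * c"
    by (simp_all add: field_simps)
  then have "cf_z0 \<iota> x * (P * v') * (c / P) \<in> R" "P * v' * (c / P) \<in> R"
    using R_mult[OF cf_z0_in_R[OF x(2)] v'R] v'R by simp_all
  then show "row1 (step_matrix x) (x * v) v * (c / P) \<in> R" "row2 (step_matrix x) (x * v) v * (c / P) \<in> R"
    unfolding step_matrix_def matrix_mul_assoc[symmetric] row_mult(1)[of "cf_Q \<iota> x"]
      row_mult(2)[of "cf_Q \<iota> x"] rows
    by (rule integral_row_in_R[OF integral_cf_Q])+
qed

primrec path_matrix :: "complex \<Rightarrow> nat \<Rightarrow> rat^2^2" where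
  "path_matrix z 0 = mat 1"
| "path_matrix z (Suc n) = step_matrix ((cf_next \<iota> ^^ n) z) ** path_matrix z n"

lemma matrix_inv_cf_B: "matrix_inv (cf_B \<iota> z n) = path_matrix z n"
proof (rule matrix_inv_eqI, induction n)
  case (Suc n)
  let ?T = "step_matrix ((cf_next \<iota> ^^ n) z)"
  have "invertible ?T" using det_step_matrix by (simp add: invertible_det_nz)
  then obtain T' where T': "?T ** T' = mat 1" by (auto simp: invertible_def)
  then have A: "cf_A \<iota> z (Suc n) = T'"
    using matrix_inv_eqI by (simp add: cf_A_def cf_x_def step_matrix_def)
  have T: "T' ** ?T = mat 1" using T' by (simp add: matrix_left_right_inverse)
  have "cf_B \<iota> z (Suc n) ** path_matrix z (Suc n) = cf_B \<iota> z n ** (T' ** ?T) ** path_matrix z n"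
    by (simp only: A cf_B.simps path_matrix.simps matrix_mul_assoc)
  then show ?case using Suc by (simp add: T)
qed simp

lemma det_path_matrix: "det (path_matrix z n) = 1"
  by (induction n) (simp_all add: det_mul det_step_matrix)

lemma path_matrix_p_fractions: "path_matrix z n $ i $ j \<in> p_fractions CARD('p)"
proof (induction n arbitrary: i j)
  case 0
  then show ?case by (simp add: mat_def)
next
  case (Suc n)
  then show ?case
    by (auto simp: matrix_mult_2 intro!: p_fractions_add p_fractions_mult step_matrix_p_fractions p_pos)
qed

lemma sends_path_matrix:
  assumes "complete_quotient D z"
  shows "sends (path_matrix z n) z ((cf_next \<iota> ^^ n) z)"
  by (induction n)
    (auto intro: sends_mat_1 sends_mult sends_step_matrix complete_quotient_iterate[OF assms])

lemma path_matrix_gains: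
  assumes "complete_quotient D z" "z \<in> R"
  shows "row1 (path_matrix z n) z 1 / P ^ n \<in> R \<and> row2 (path_matrix z n) z 1 / P ^ n \<in> R"
proof (induction n)
  case (Suc n)
  let ?x = "(cf_next \<iota> ^^ n) z" and ?v = "row2 (path_matrix z n) z 1"
  have "row1 (path_matrix z n) z 1 = ?x * ?v"
    using sends_path_matrix[OF assms(1), of n] unfolding sends_def by (metis mult.right_neutral)
  then show ?case
    using Suc step_matrix_gains_one[OF complete_quotient_iterate[OF assms(1)], of n ?v "1 / P ^ n"]
    by (simp add: row_mult field_simps)
qed (use assms in simp)

lemma path_matrix_loses:
  assumes "u \<in> R"
  shows "row1 (path_matrix z n) u 1 * P ^ n \<in> R \<and> row2 (path_matrix z n) u 1 * P ^ n \<in> R"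
proof (induction n)
  case (Suc n)
  then show ?case
    using step_matrix_loses_one[of "row1 (path_matrix z n) u 1" "P ^ n" "row2 (path_matrix z n) u 1"]
    by (simp add: row_mult mult.commute)
qed (use assms in simp)

end

section \<open>Groups with a discrete order function\<close>

text \<open>
  The image of \<open>f\<close> is the subgroup of the integers generated by its least positive element \<open>f g\<close>.  Hence
  \<open>f\<close>, divided by \<open>f g\<close>, identifies the group modulo its torsion subgroup with the integers, and sends
  \<open>g\<close> to \<open>1\<close>.
\<close>

lemma generates_mod_torsionI:
  fixes f :: "'a \<Rightarrow> int"
  assumes G: "comm_group G" and f: "f \<in> hom G integer_group"
    and ker: "\<And>u. u \<in> carrier G \<Longrightarrow> f u = 0 \<longleftrightarrow> u \<in> torsion G"
    and g: "g \<in> carrier G" "f g > 0"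
    and least: "\<And>u. u \<in> carrier G \<Longrightarrow> f u > 0 \<Longrightarrow> f g \<le> f u"
  shows "generates_mod_torsion G g"
proof -
  interpret G: comm_group G by (rule G)
  interpret F: group_hom G integer_group f
    by (simp add: group_hom_def group_hom_axioms_def f G.group_axioms)
  define N where "N = f g"
  have pow: "f (g [^]\<^bsub>G\<^esub> k) = k * N" for k :: int
    using F.hom_int_pow[OF g(1), of k] by (simp add: N_def)
  have dvd: "N dvd f u" if u: "u \<in> carrier G" for u
  proof -
    \<comment> \<open>Division with remainder: an element whose value is the remainder contradicts minimality.\<close>
    define w where "w = u \<otimes>\<^bsub>G\<^esub> g [^]\<^bsub>G\<^esub> (- (f u div N))"
    have w: "w \<in> carrier G" using u g(1) by (simp add: w_def)
    have "f w = f u + (- (f u div N)) * N"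
      using F.hom_mult[OF u G.int_pow_closed[OF g(1), of "- (f u div N)"]] pow by (simp add: w_def)
    then have "f w = f u mod N" by (simp add: minus_div_mult_eq_mod)
    moreover from this have "0 \<le> f w" "f w < N" using g(2) by (simp_all add: N_def)
    ultimately show ?thesis using least[OF w] by (force simp: N_def dvd_eq_mod_eq_0)
  qed
  define h where "h = (\<lambda>u. f u div N)"
  have f_h: "f u = h u * N" if "u \<in> carrier G" for u
    using dvd[OF that] by (simp add: h_def)
  have "h \<in> hom G integer_group"
    by (rule homI) (use F.hom_mult dvd in \<open>simp_all add: h_def div_plus_div_distrib_dvd_left\<close>)
  then interpret H: group_hom G integer_group h
    by (simp add: group_hom_def group_hom_axioms_def G.group_axioms)
  have ker_h: "kernel G integer_group h = torsion G"
    using ker f_h g(2) by (auto simp: kernel_def torsion_def N_def)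
  have hg: "h (g [^]\<^bsub>G\<^esub> k) = k" for k :: int
    using pow[of k] f_h[of "g [^]\<^bsub>G\<^esub> k"] g by (simp add: N_def)
  then have "k \<in> h ` carrier G" for k
    using G.int_pow_closed[OF g(1), of k] by (metis image_eqI)
  then have "h ` carrier G = carrier integer_group" by auto
  then have iso: "G Mod torsion G \<cong> integer_group"
    using H.FactGroup_iso by (simp add: ker_h)
  have normal: "torsion G \<lhd> G" using H.normal_kernel by (simp add: ker_h)
  then interpret T: normal "torsion G" G .
  interpret M: group "G Mod torsion G" by (rule T.factorgroup_is_group)
  interpret C: group_hom G "G Mod torsion G" "\<lambda>a. torsion G #>\<^bsub>G\<^esub> a"
    by (simp add: group_hom_def group_hom_axioms_def G.group_axioms M.group_axioms T.r_coset_hom_Mod)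
  have "generate (G Mod torsion G) {torsion G #>\<^bsub>G\<^esub> g} = carrier (G Mod torsion G)"
  proof
    show "generate (G Mod torsion G) {torsion G #>\<^bsub>G\<^esub> g} \<subseteq> carrier (G Mod torsion G)"
      using C.hom_closed[OF g(1)] by (intro M.generate_incl) simp
    show "carrier (G Mod torsion G) \<subseteq> generate (G Mod torsion G) {torsion G #>\<^bsub>G\<^esub> g}"
    proof
      fix Y assume "Y \<in> carrier (G Mod torsion G)"
      then obtain u where u: "u \<in> carrier G" "Y = torsion G #>\<^bsub>G\<^esub> u"
        by (auto simp: FactGroup_def RCOSETS_def)
      let ?v = "g [^]\<^bsub>G\<^esub> h u"
      have v: "?v \<in> carrier G" using g(1) by simp
      have "h (u \<otimes>\<^bsub>G\<^esub> inv\<^bsub>G\<^esub> ?v) = h u + - h ?v"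
        using H.hom_mult[OF u(1) G.inv_closed[OF v]] H.hom_inv[OF v]
        by (simp only: mult_integer_group inv_integer_group)
      also have "\<dots> = 0" by (simp only: hg)
      finally have "u \<otimes>\<^bsub>G\<^esub> inv\<^bsub>G\<^esub> ?v \<in> kernel G integer_group h"
        using G.m_closed[OF u(1) G.inv_closed[OF v]] unfolding kernel_def one_integer_group by blast
      then have "u \<otimes>\<^bsub>G\<^esub> inv\<^bsub>G\<^esub> ?v \<in> torsion G" unfolding ker_h .
      moreover have "u = (u \<otimes>\<^bsub>G\<^esub> inv\<^bsub>G\<^esub> ?v) \<otimes>\<^bsub>G\<^esub> ?v"
        using u(1) v G.inv_solve_right' G.m_closed[OF u(1) G.inv_closed[OF v]] by metis
      ultimately have "u \<in> torsion G #>\<^bsub>G\<^esub> ?v" by (auto simp: r_coset_def)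
      then have "Y = torsion G #>\<^bsub>G\<^esub> ?v"
        using G.repr_independence[OF _ v T.subgroup_axioms] u(2) by simp
      also have "\<dots> = (torsion G #>\<^bsub>G\<^esub> g) [^]\<^bsub>G Mod torsion G\<^esub> h u"
        by (rule C.hom_int_pow[OF g(1)])
      finally show "Y \<in> generate (G Mod torsion G) {torsion G #>\<^bsub>G\<^esub> g}"
        unfolding M.generate_pow[OF C.hom_closed[OF g(1)]] by blast
    qed
  qed
  then show ?thesis unfolding generates_mod_torsion_def using g(1) iso by blast
qed

section \<open>The expansion of the generator of a quadratic order\<close>

text \<open>
  A reduced generator \<open>\<theta>\<close> of a quadratic order in which \<open>p\<close> splits without dividing the conductor:
  \<open>\<theta> - cnj \<theta>\<close> generates the different, and that it is a p-adic unit means that \<open>p\<close> divides neither the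
  conductor nor the discriminant.
\<close>

locale quadratic_generator = padic_identification \<iota> P
  for \<iota> :: "complex \<Rightarrow> 'p::prime_card padic alg_closure" and P +
  fixes \<theta> :: complex and b c :: int
  assumes theta_eq: "\<theta> ^ 2 + of_int b * \<theta> + of_int c = 0"
    and theta_fund: "\<theta> \<in> fund_dom"
    and theta_K: "\<theta> \<in> K" "cnj \<theta> \<in> K"
    and different_unit: "1 / (\<theta> - cnj \<theta>) \<in> R"
    and theta_defined: "cf_defined \<iota> \<theta>"
begin

definition \<Delta> :: int where "\<Delta> = b ^ 2 - 4 * c"

definition \<delta> :: complex where "\<delta> = \<theta> - cnj \<theta>"

lemma Im_theta: "Im \<theta> > 0"
  using fund_dom_bounds[OF theta_fund] by simp

lemma delta_nonzero: "\<delta> \<noteq> 0"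
  using Im_theta by (simp add: \<delta>_def complex_eq_iff)

lemma theta_square: "\<theta> * \<theta> = - of_int b * \<theta> - of_int c"
proof -
  have "\<theta> * \<theta> = (\<theta> ^ 2 + of_int b * \<theta> + of_int c) - of_int b * \<theta> - of_int c"
    by (simp add: power2_eq_square)
  then show ?thesis by (simp add: theta_eq)
qed

lemma cnj_theta: "cnj \<theta> = - of_int b - \<theta>"
proof -
  have "cnj (\<theta> * \<theta>) = cnj (- of_int b * \<theta> - of_int c)" by (simp only: theta_square)
  then have "cnj \<theta> * cnj \<theta> = - of_int b * cnj \<theta> - of_int c" by simp
  then have conj_eq: "cnj \<theta> * cnj \<theta> + of_int b * cnj \<theta> + of_int c = 0" by simp
  have "\<delta> * (\<theta> + cnj \<theta> + of_int b) = (\<theta> ^ 2 + of_int b * \<theta> + of_int c)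
      - (cnj \<theta> * cnj \<theta> + of_int b * cnj \<theta> + of_int c)"
    by (simp add: \<delta>_def power2_eq_square algebra_simps)
  then have "\<delta> * (\<theta> + cnj \<theta> + of_int b) = 0" by (simp only: theta_eq conj_eq) simp
  then have "\<theta> + cnj \<theta> + of_int b = 0" using delta_nonzero by simp
  moreover have "cnj \<theta> = (\<theta> + cnj \<theta> + of_int b) - of_int b - \<theta>" by simp
  ultimately show ?thesis by simp
qed

lemma Re_theta: "2 * Re \<theta> = - real_of_int b"
  using arg_cong[OF cnj_theta, of Re] by simp

lemma Im_theta_square: "(2 * Im \<theta>) ^ 2 = - real_of_int \<Delta>"
proof -
  have "Re \<theta> * Re \<theta> - Im \<theta> * Im \<theta> = - real_of_int b * Re \<theta> - real_of_int c"
    using arg_cong[OF theta_square, of Re] by simp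
  then have "4 * (Im \<theta> * Im \<theta>) = (2 * Re \<theta>) * (2 * Re \<theta>) + 2 * real_of_int b * (2 * Re \<theta>) + 4 * real_of_int c"
    by (simp add: algebra_simps)
  then show ?thesis unfolding Re_theta by (simp add: power2_eq_square \<Delta>_def)
qed

lemma Delta_neg: "\<Delta> < 0"
proof -
  have "(2 * Im \<theta>) ^ 2 > 0" using Im_theta by simp
  then show ?thesis unfolding Im_theta_square by simp
qed

lemma theta_complete_quotient: "complete_quotient \<Delta> \<theta>"
  using theta_eq theta_K Im_theta
  by (auto simp: complete_quotient_def \<Delta>_def intro!: quad_rootI[where A = 1])

text \<open>
  The p-adic integers are integrally closed: if \<open>\<theta>\<close> were not one of them, then \<open>\<theta> = - b - c / \<theta>\<close> would
  express it by p-adic integers.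
\<close>

lemma theta_R: "\<theta> \<in> R"
proof (rule ccontr)
  assume nR: "\<theta> \<notin> R"
  have y: "1 / (P * \<theta>) \<in> R" by (rule R_valuation_ring[OF theta_K(1) nR])
  have "\<theta> \<noteq> 0" using Im_theta by auto
  then have "\<theta> = - of_int b - of_int c * (P * (1 / (P * \<theta>)))"
    using theta_square by (simp add: field_simps)
  also have "\<dots> \<in> R" using y by (intro R_diff R_mult R_uminus R_of_int R_P)
  finally show False using nR by simp
qed

lemma cnj_theta_R: "cnj \<theta> \<in> R"
  unfolding cnj_theta by (intro R_diff R_uminus R_of_int theta_R)

text \<open>
  \<open>\<theta>\<close> is the only point of its discriminant in the fundamental domain whose equation has leading
  coefficient \<open>\<plusminus>1\<close>.  The height of a root is inversely proportional to that coefficient, so the bound on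
  the imaginary part forces the coefficient; then twice the real parts are integers of the same
  parity in \<open>[- 1, 1)\<close>.
\<close>

lemma principal_form_unique:
  assumes "x \<in> fund_dom" "quad_root \<Delta> x" "Im \<theta> \<le> Im x"
  shows "x = \<theta>"
proof -
  note bx = fund_dom_bounds[OF assms(1)] and bt = fund_dom_bounds[OF theta_fund]
  obtain A B C :: int where A: "A \<noteq> 0" "2 * real_of_int A * Re x = - real_of_int B"
    "(2 * real_of_int A * Im x) ^ 2 = - real_of_int \<Delta>" "B ^ 2 - 4 * A * C = \<Delta>"
    by (rule quad_root_coordinates[OF assms(2) Delta_neg bx(1)])
  have "(2 * (\<bar>real_of_int A\<bar> * Im x)) ^ 2 = (2 * Im \<theta>) ^ 2"
    using A(3) Im_theta_square by (simp add: power_mult_distrib)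
  then have im: "\<bar>real_of_int A\<bar> * Im x = Im \<theta>"
    using bx(1) bt(1) by (simp add: power2_eq_iff_nonneg)
  then have "\<bar>real_of_int A\<bar> * Im x \<le> 1 * Im x" using assms(3) by simp
  then have "\<bar>real_of_int A\<bar> \<le> 1" using bx(1) mult_le_cancel_right_pos by blast
  then have A1: "\<bar>A\<bar> = 1" using A(1) by linarith
  then have im_eq: "Im x = Im \<theta>" using im by (simp flip: of_int_abs)
  have "A = 1 \<or> A = - 1" using A1 by linarith
  then obtain B' where B': "2 * Re x = real_of_int B'" "even (B' - B)"
  proof
    assume "A = 1"
    then show ?thesis using A(2) that[of "- B"] by simp
  next
    assume "A = - 1"
    then show ?thesis using A(2) that[of B] by simp
  qed
  have "B ^ 2 - b ^ 2 = 2 * (2 * (A * C - c))"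
    using A(4) by (simp add: \<Delta>_def algebra_simps)
  then have "even (B ^ 2 - b ^ 2)" by simp
  then have "even (B' + b)" using B'(2) by simp
  moreover have "real_of_int (B' + b) = 2 * Re x - 2 * Re \<theta>" using B'(1) Re_theta by simp
  then have "- 2 < real_of_int (B' + b)" "real_of_int (B' + b) < 2" using bx bt by linarith+
  then have "- 2 < B' + b" "B' + b < 2" by linarith+
  ultimately have "B' + b = 0" by presburger
  then have "Re x = Re \<theta>" using B'(1) Re_theta by linarith
  then show ?thesis using im_eq by (simp add: complex_eq_iff)
qed

abbreviation \<xi> :: "nat \<Rightarrow> complex" where "\<xi> n \<equiv> (cf_next \<iota> ^^ n) \<theta>"

text \<open>
  The complete quotient \<open>\<xi> n\<close> is the ratio of \<open>\<alpha> n\<close> and \<open>\<beta> n\<close>, which span a lattice homothetic to the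
  one spanned by \<open>\<xi> n\<close> and \<open>1\<close>.
\<close>

definition \<alpha> :: "nat \<Rightarrow> complex" where "\<alpha> n = row1 (path_matrix \<theta> n) \<theta> 1"
definition \<beta> :: "nat \<Rightarrow> complex" where "\<beta> n = row2 (path_matrix \<theta> n) \<theta> 1"

lemma alpha_eq: "\<alpha> n = \<xi> n * \<beta> n"
  using sends_path_matrix[OF theta_complete_quotient, of n]
  unfolding sends_def \<alpha>_def \<beta>_def by (metis mult.right_neutral)

lemma alpha_beta_R: "\<alpha> n / P ^ n \<in> R" "\<beta> n / P ^ n \<in> R"
  using path_matrix_gains[OF theta_complete_quotient theta_R] by (simp_all add: \<alpha>_def \<beta>_def)

lemma cnj_alpha_beta_R: "cnj (\<alpha> n) * P ^ n \<in> R" "cnj (\<beta> n) * P ^ n \<in> R"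
  using path_matrix_loses[OF cnj_theta_R, of \<theta> n]
    row_cnj[of "path_matrix \<theta> n" \<theta> 1] by (simp_all add: \<alpha>_def \<beta>_def)

lemma alpha_beta_det: "\<alpha> n * cnj (\<beta> n) - cnj (\<alpha> n) * \<beta> n = \<delta>"
  using row_det[of "path_matrix \<theta> n" \<theta> 1 "cnj \<theta>" 1] row_cnj[of "path_matrix \<theta> n" \<theta> 1]
  by (simp add: det_path_matrix \<alpha>_def \<beta>_def \<delta>_def)

text \<open>
  The transformation rule of the imaginary part under a matrix of determinant one.
\<close>

lemma norm_beta: "cmod (\<beta> n) ^ 2 * Im (\<xi> n) = Im \<theta>"
proof -
  have "(\<xi> n - cnj (\<xi> n)) * (\<beta> n * cnj (\<beta> n)) = \<theta> - cnj \<theta>"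
    using alpha_beta_det[of n] by (simp add: alpha_eq \<delta>_def algebra_simps)
  then have "Im ((\<xi> n - cnj (\<xi> n)) * (\<beta> n * cnj (\<beta> n))) = 2 * Im \<theta>" by simp
  then show ?thesis
    by (simp only: cmod_power2) (simp add: complex_mult_cnj algebra_simps power2_eq_square)
qed

lemma beta_nonzero: "\<beta> n \<noteq> 0"
  using norm_beta[of n] Im_theta by auto

lemma R_cancel_delta: "x * \<delta> \<in> R \<Longrightarrow> x \<in> R"
proof -
  assume "x * \<delta> \<in> R"
  then have "x * \<delta> * (1 / \<delta>) \<in> R" using different_unit by (intro R_mult[of "x * \<delta>"]) (simp_all add: \<delta>_def)
  then show ?thesis using delta_nonzero by simp
qed

lemma R_cancel_P: "x / P ^ n \<in> R \<Longrightarrow> y * P ^ n \<in> R \<Longrightarrow> x * y \<in> R"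
  using R_mult[of "x / P ^ n" "y * P ^ n"] by simp

lemma alpha_beta_entries:
  obtains q r s t where "q \<in> p_fractions CARD('p)" "r \<in> p_fractions CARD('p)"
    "s \<in> p_fractions CARD('p)" "t \<in> p_fractions CARD('p)" "q * t - r * s = 1"
    "\<alpha> n = of_rat q * \<theta> + of_rat r" "\<beta> n = of_rat s * \<theta> + of_rat t"
proof (rule that)
  let ?C = "path_matrix \<theta> n"
  show "?C $ 1 $ 1 * ?C $ 2 $ 2 - ?C $ 1 $ 2 * ?C $ 2 $ 1 = 1"
    using det_path_matrix[of \<theta> n] by (simp add: det_2)
  show "\<alpha> n = of_rat (?C $ 1 $ 1) * \<theta> + of_rat (?C $ 1 $ 2)"
    "\<beta> n = of_rat (?C $ 2 $ 1) * \<theta> + of_rat (?C $ 2 $ 2)"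
    by (simp_all add: \<alpha>_def \<beta>_def row_defs)
qed (rule path_matrix_p_fractions)+

text \<open>
  Membership in \<open>\<int>[\<theta>][1/p]\<close>.
\<close>

definition in_p_order :: "complex \<Rightarrow> bool" where
  "in_p_order u \<longleftrightarrow> (\<exists>x \<in> p_fractions CARD('p). \<exists>y \<in> p_fractions CARD('p). u = of_rat x + of_rat y * \<theta>)"

definition units :: "complex set" where
  "units = {u. in_p_order u \<and> u * cnj u = 1}"

lemma in_p_orderI: "x \<in> p_fractions CARD('p) \<Longrightarrow> y \<in> p_fractions CARD('p) \<Longrightarrow>
    u = of_rat x + of_rat y * \<theta> \<Longrightarrow> in_p_order u"
  by (auto simp: in_p_order_def)

lemma in_p_orderE:
  assumes "in_p_order u"
  obtains x y where "x \<in> p_fractions CARD('p)" "y \<in> p_fractions CARD('p)" "u = of_rat x + of_rat y * \<theta>"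
  using assms by (auto simp: in_p_order_def)

lemma in_p_order_mult:
  assumes "in_p_order u" "in_p_order v"
  shows "in_p_order (u * v)"
proof -
  obtain x y where u: "x \<in> p_fractions CARD('p)" "y \<in> p_fractions CARD('p)" "u = of_rat x + of_rat y * \<theta>"
    using assms(1) by (rule in_p_orderE)
  obtain x' y' where v: "x' \<in> p_fractions CARD('p)" "y' \<in> p_fractions CARD('p)" "v = of_rat x' + of_rat y' * \<theta>"
    using assms(2) by (rule in_p_orderE)
  show ?thesis
  proof (rule in_p_orderI)
    show "x * x' - of_int c * (y * y') \<in> p_fractions CARD('p)"
      "x * y' + y * x' - of_int b * (y * y') \<in> p_fractions CARD('p)"
      using u v by (intro p_fractions_diff p_fractions_add p_fractions_mult p_pos p_fractions_int; simp)+
    have "u * v = of_rat (x * x') + of_rat (x * y' + y * x') * \<theta> + of_rat (y * y') * (\<theta> * \<theta>)"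
      by (simp add: u v of_rat_add of_rat_mult algebra_simps)
    also have "\<dots> = of_rat (x * x' - of_int c * (y * y')) + of_rat (x * y' + y * x' - of_int b * (y * y')) * \<theta>"
      unfolding theta_square by (simp add: of_rat_add of_rat_diff of_rat_mult algebra_simps)
    finally show "u * v = \<dots>" .
  qed
qed

lemma in_p_order_cnj:
  assumes "in_p_order u"
  shows "in_p_order (cnj u)"
proof -
  obtain x y where u: "x \<in> p_fractions CARD('p)" "y \<in> p_fractions CARD('p)" "u = of_rat x + of_rat y * \<theta>"
    using assms by (rule in_p_orderE)
  show ?thesis
  proof (rule in_p_orderI)
    show "x - of_int b * y \<in> p_fractions CARD('p)" "- y \<in> p_fractions CARD('p)"
      using u by (auto intro!: p_fractions_diff p_fractions_mult p_pos p_fractions_uminus)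
    show "cnj u = of_rat (x - of_int b * y) + of_rat (- y) * \<theta>"
      by (simp add: u cnj_theta of_rat_diff of_rat_mult of_rat_minus algebra_simps)
  qed
qed

lemma in_p_order_K:
  assumes "in_p_order u"
  shows "u \<in> K"
proof -
  obtain x y where u: "x \<in> p_fractions CARD('p)" "y \<in> p_fractions CARD('p)" "u = of_rat x + of_rat y * \<theta>"
    using assms by (rule in_p_orderE)
  have "of_rat q \<in> K" if q: "q \<in> p_fractions CARD('p)" for q
  proof -
    obtain m n where "q = of_int m / of_nat CARD('p) ^ n" using q by (auto simp: p_fractions_def)
    then have "of_rat q = of_int m / P ^ n" by (simp add: P_def of_rat_divide of_rat_power)
    then show ?thesis by (simp add: K_divide)
  qed
  then show ?thesis using u theta_K by (auto intro!: K_add K_mult)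
qed

text \<open>
  As \<open>\<theta> - cnj \<theta>\<close> is a p-adic unit, the coordinates of \<open>u\<close> can be computed from \<open>u\<close> and its conjugate
  without introducing a denominator \<open>p\<close>.
\<close>

lemma in_p_order_integral:
  assumes "in_p_order u" "u \<in> R" "cnj u \<in> R"
  obtains m n where "u = of_int m + of_int n * \<theta>"
proof -
  obtain x y where u: "x \<in> p_fractions CARD('p)" "y \<in> p_fractions CARD('p)" "u = of_rat x + of_rat y * \<theta>"
    using assms(1) by (rule in_p_orderE)
  have "of_rat y * \<delta> = u - cnj u" by (simp add: u \<delta>_def algebra_simps)
  also have "\<dots> \<in> R" using assms(2,3) by (rule R_diff)
  finally have yR: "of_rat y \<in> R" by (rule R_cancel_delta)
  have "of_rat x = u - of_rat y * \<theta>" by (simp add: u)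
  also have "\<dots> \<in> R" using assms yR theta_R by (intro R_diff R_mult)
  finally have "of_rat x \<in> R" .
  then obtain m n where "x = of_int m" "y = of_int n" using p_fraction_in_R u yR by metis
  then show ?thesis using that u by simp
qed

lemma units_nonzero: "u \<in> units \<Longrightarrow> u \<noteq> 0"
  by (auto simp: units_def)

lemma units_K: "u \<in> units \<Longrightarrow> u \<in> K"
  by (auto simp: units_def in_p_order_K)

lemma units_cnj: "u \<in> units \<Longrightarrow> cnj u \<in> units"
  by (simp add: units_def in_p_order_cnj mult.commute)

lemma units_cnj_eq: "u \<in> units \<Longrightarrow> cnj u = 1 / u"
  using units_nonzero[of u] by (simp add: units_def field_simps)

lemma units_norm:
  assumes "u \<in> units"
  shows "cmod u = 1"
proof -
  have "cmod u * cmod u = 1"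
    using assms by (simp add: units_def) (metis complex_mod_cnj norm_mult norm_one)
  then show ?thesis by (simp add: square_eq_1_iff) (smt (verit) norm_ge_zero)
qed

lemma unitsI: "in_p_order u \<Longrightarrow> cmod u = 1 \<Longrightarrow> u \<in> units"
  by (simp add: units_def complex_norm_square[symmetric])

lemma units_mult: "u \<in> units \<Longrightarrow> v \<in> units \<Longrightarrow> u * v \<in> units"
  by (rule unitsI) (use in_p_order_mult units_norm in \<open>auto simp: norm_mult units_def\<close>)

lemma units_one: "1 \<in> units"
  by (rule unitsI) (auto intro: in_p_orderI[of 1 0])

text \<open>
  The unit is an element of the lattice spanned by \<open>\<alpha> n\<close> and \<open>\<beta> n\<close>, with integral coordinates \<open>g'\<close> and
  \<open>h'\<close>.  Its absolute value is one, while \<open>\<beta> n\<close> is a shortest non-zero vector of that lattice because \<open>\<xi> n\<close> is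
  in the fundamental domain.  So \<open>\<bar>\<beta> n\<bar> \<le> 1\<close>, and \<open>\<xi> n\<close> is at least as high as \<open>\<theta>\<close>.
\<close>

lemma unit_gives_return:
  assumes u: "u \<in> units" and "n > 0" and uR: "u / P ^ n \<in> R" "cnj u * P ^ n \<in> R"
  shows "\<xi> n = \<theta>"
proof -
  obtain x y where xy: "x \<in> p_fractions CARD('p)" "y \<in> p_fractions CARD('p)"
      "u = of_rat x + of_rat y * \<theta>"
    using u in_p_orderE by (auto simp: units_def)
  obtain q r s t where C: "q \<in> p_fractions CARD('p)" "r \<in> p_fractions CARD('p)"
      "s \<in> p_fractions CARD('p)" "t \<in> p_fractions CARD('p)" "q * t - r * s = 1"
      "\<alpha> n = of_rat q * \<theta> + of_rat r" "\<beta> n = of_rat s * \<theta> + of_rat t"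
    by (rule alpha_beta_entries)
  \<comment> \<open>The coordinates of \<open>u\<close>, by Cramer's rule for a matrix of determinant one.\<close>
  define g where "g = y * t - x * s"
  define h where "h = x * q - y * r"
  have "g * q + h * s = y * (q * t - r * s)" "g * r + h * t = x * (q * t - r * s)"
    by (simp_all add: g_def h_def algebra_simps)
  then have gh: "g * q + h * s = y" "g * r + h * t = x" by (simp_all add: C(5))
  have u_eq: "u = of_rat g * \<alpha> n + of_rat h * \<beta> n"
    unfolding xy(3) gh[symmetric] C(6,7) by (simp add: of_rat_add of_rat_mult algebra_simps)
  have cnj_u: "cnj u = of_rat g * cnj (\<alpha> n) + of_rat h * cnj (\<beta> n)"
    by (simp add: u_eq)
  \<comment> \<open>Both products have order at least zero, since the orders \<open>n\<close> and \<open>- n\<close> cancel.\<close>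
  have "of_rat g * \<delta> = u * cnj (\<beta> n) - cnj u * \<beta> n"
    unfolding alpha_beta_det[of n, symmetric] cnj_u unfolding u_eq by (simp add: algebra_simps)
  also have "\<dots> = u * cnj (\<beta> n) - \<beta> n * cnj u" by simp
  also have "\<dots> \<in> R"
    by (rule R_diff[OF R_cancel_P[OF uR(1) cnj_alpha_beta_R(2)] R_cancel_P[OF alpha_beta_R(2) uR(2)]])
  finally have gR: "of_rat g \<in> R" by (rule R_cancel_delta)
  have "of_rat h * \<delta> = cnj u * \<alpha> n - u * cnj (\<alpha> n)"
    unfolding alpha_beta_det[of n, symmetric] cnj_u unfolding u_eq by (simp add: algebra_simps)
  also have "\<dots> = \<alpha> n * cnj u - u * cnj (\<alpha> n)" by simp
  also have "\<dots> \<in> R"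
    by (rule R_diff[OF R_cancel_P[OF alpha_beta_R(1) uR(2)] R_cancel_P[OF uR(1) cnj_alpha_beta_R(1)]])
  finally have hR: "of_rat h \<in> R" by (rule R_cancel_delta)
  have "g \<in> p_fractions CARD('p)" "h \<in> p_fractions CARD('p)"
    unfolding g_def h_def using xy(1,2) C(1-4) p_pos
    by (auto intro!: p_fractions_diff p_fractions_mult)
  then obtain g' h' where gh': "g = of_int g'" "h = of_int h'" using p_fraction_in_R gR hR by metis
  have "u = \<beta> n * (of_int g' * \<xi> n + of_int h')"
    by (simp add: u_eq gh' alpha_eq algebra_simps)
  then have "1 = cmod (\<beta> n) * cmod (of_int g' * \<xi> n + of_int h')"
    using units_norm[OF u] by (metis norm_mult)
  moreover have gh0: "g' \<noteq> 0 \<or> h' \<noteq> 0" using units_nonzero[OF u] by (auto simp: u_eq gh')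
  moreover have X_fund: "\<xi> n \<in> fund_dom" using cf_iterate_in_fund_dom[OF theta_defined \<open>n > 0\<close>] .
  ultimately have "cmod (\<beta> n) * 1 \<le> 1"
    using mult_left_mono[OF fund_dom_form_ge_1[OF X_fund gh0] norm_ge_zero[of "\<beta> n"]] by simp
  then have "cmod (\<beta> n) ^ 2 \<le> 1" by (simp add: power_le_one)
  then have "cmod (\<beta> n) ^ 2 * Im (\<xi> n) \<le> 1 * Im (\<xi> n)"
    using fund_dom_bounds(1)[OF X_fund] by (intro mult_right_mono) auto
  then have "Im \<theta> \<le> Im (\<xi> n)" using norm_beta[of n] by simp
  moreover have "quad_root \<Delta> (\<xi> n)"
    using complete_quotient_iterate[OF theta_complete_quotient] by (simp add: complete_quotient_def)
  ultimately show ?thesis using principal_form_unique X_fund by blast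
qed

lemma beta_coords: "in_p_order (\<beta> n)"
  by (rule in_p_orderI[of "path_matrix \<theta> n $ 2 $ 2" "path_matrix \<theta> n $ 2 $ 1"])
    (auto simp: \<beta>_def row2_def path_matrix_p_fractions)

text \<open>
  The order of \<open>\<beta> n\<close> is at least \<open>n\<close>, and that of its inverse, the conjugate, is at least \<open>- n\<close>.
\<close>

lemma return_gives_unit:
  assumes "\<xi> n = \<theta>"
  shows "\<beta> n \<in> units" "ord (\<beta> n) = int n"
proof -
  have "cmod (\<beta> n) ^ 2 = 1" using norm_beta[of n] Im_theta by (simp add: assms)
  then have "cmod (\<beta> n) = 1" by (simp add: power2_eq_1_iff) (metis norm_ge_zero not_one_le_zero neg_0_le_iff_le)
  then show u: "\<beta> n \<in> units" using beta_coords unitsI by blast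
  show "ord (\<beta> n) = int n"
    using alpha_beta_R(2)[of n] cnj_alpha_beta_R(2)[of n] beta_nonzero[of n]
    by (intro ord_eqI) (simp_all add: units_cnj_eq[OF u])
qed

text \<open>
  If the complete quotients after \<open>m < n\<close> steps agree, then \<open>\<beta> n / \<beta> m\<close> is an eigenvalue of the quotient
  of the two path matrices, hence a p-unit of norm one; its order is \<open>n - m\<close>.
\<close>

lemma exists_return:
  obtains n where "n > 0" "\<xi> n = \<theta>"
proof -
  obtain m n where mn: "m < n" "\<xi> m = \<xi> n"
    by (rule cf_iterate_repeats[OF theta_complete_quotient Delta_neg theta_defined])
  obtain q r s t where C: "q \<in> p_fractions CARD('p)" "r \<in> p_fractions CARD('p)"
      "s \<in> p_fractions CARD('p)" "t \<in> p_fractions CARD('p)" "q * t - r * s = 1"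
      "\<alpha> m = of_rat q * \<theta> + of_rat r" "\<beta> m = of_rat s * \<theta> + of_rat t"
    by (rule alpha_beta_entries)
  obtain q' r' s' t' where D: "q' \<in> p_fractions CARD('p)" "r' \<in> p_fractions CARD('p)"
      "s' \<in> p_fractions CARD('p)" "t' \<in> p_fractions CARD('p)" "q' * t' - r' * s' = 1"
      "\<alpha> n = of_rat q' * \<theta> + of_rat r'" "\<beta> n = of_rat s' * \<theta> + of_rat t'"
    by (rule alpha_beta_entries)
  define \<eta> where "\<eta> = \<beta> n / \<beta> m"
  have eta: "\<beta> n = \<eta> * \<beta> m" "\<alpha> n = \<eta> * \<alpha> m"
    using beta_nonzero[of m] by (simp_all add: \<eta>_def alpha_eq mn(2))
  have "cmod (\<beta> n) ^ 2 * Im (\<xi> n) = cmod (\<beta> m) ^ 2 * Im (\<xi> n)"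
    using norm_beta[of n] norm_beta[of m] by (simp add: mn(2))
  moreover have "Im (\<xi> n) \<noteq> 0" using norm_beta[of n] Im_theta by auto
  ultimately have "cmod (\<beta> n) = cmod (\<beta> m)" by simp
  then have norm: "cmod \<eta> = 1" using beta_nonzero[of m] by (simp add: \<eta>_def norm_divide)
  \<comment> \<open>The lower row of the inverse of the path matrix after \<open>m\<close> steps sends \<open>(\<alpha> m, \<beta> m)\<close> to \<open>1\<close>.\<close>
  have "of_rat q * \<beta> m - of_rat s * \<alpha> m = of_rat (q * t - r * s)"
    by (simp add: C(6,7) of_rat_diff of_rat_mult algebra_simps)
  then have "\<eta> = \<eta> * (of_rat q * \<beta> m - of_rat s * \<alpha> m)" by (simp add: C(5))
  also have "\<dots> = of_rat q * \<beta> n - of_rat s * \<alpha> n"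
    unfolding eta by (simp add: algebra_simps)
  also have "\<dots> = of_rat (q * t' - s * r') + of_rat (q * s' - s * q') * \<theta>"
    by (simp add: D(6,7) of_rat_diff of_rat_mult algebra_simps)
  finally have "in_p_order \<eta>"
    using C(1-4) D(1-4) p_pos by (intro in_p_orderI[of "q * t' - s * r'" "q * s' - s * q'"])
      (auto intro!: p_fractions_diff p_fractions_mult)
  then have unit: "\<eta> \<in> units" using norm by (rule unitsI)
  define k where "k = n - m"
  have k: "P ^ n = P ^ k * P ^ m" using mn(1) by (simp add: k_def flip: power_add)
  have "(\<eta> / P ^ k) * \<delta> = (\<alpha> n / P ^ k) * cnj (\<beta> m) - (\<beta> n / P ^ k) * cnj (\<alpha> m)"
    unfolding alpha_beta_det[of m, symmetric] eta
    by (simp add: diff_divide_distrib right_diff_distrib mult_ac)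
  also have "\<dots> \<in> R"
  proof -
    have "\<alpha> n / P ^ k / P ^ m \<in> R" "\<beta> n / P ^ k / P ^ m \<in> R"
      using alpha_beta_R[of n] by (simp_all add: k)
    then show ?thesis by (intro R_diff R_cancel_P[OF _ cnj_alpha_beta_R(1)] R_cancel_P[OF _ cnj_alpha_beta_R(2)])
  qed
  finally have 1: "\<eta> / P ^ k \<in> R" by (rule R_cancel_delta)
  have "(cnj \<eta> * P ^ k) * \<delta> = \<alpha> m * (cnj (\<beta> n) * P ^ k) - \<beta> m * (cnj (\<alpha> n) * P ^ k)"
    unfolding alpha_beta_det[of m, symmetric] eta by (simp add: algebra_simps)
  also have "\<dots> \<in> R"
  proof -
    have "cnj (\<alpha> n) * P ^ k * P ^ m \<in> R" "cnj (\<beta> n) * P ^ k * P ^ m \<in> R"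
      using cnj_alpha_beta_R[of n] by (simp_all add: k mult.assoc)
    then show ?thesis by (intro R_diff R_cancel_P[OF alpha_beta_R(1)] R_cancel_P[OF alpha_beta_R(2)])
  qed
  finally have 2: "cnj \<eta> * P ^ k \<in> R" by (rule R_cancel_delta)
  have "k > 0" using mn(1) by (simp add: k_def)
  then show ?thesis using that unit_gives_return[OF unit _ 1 2] by blast
qed

definition unit_group :: "complex monoid" where
  "unit_group = \<lparr>carrier = units, monoid.mult = (*), one = 1\<rparr>"

lemma unit_group_simps [simp]: "carrier unit_group = units" "x \<otimes>\<^bsub>unit_group\<^esub> y = x * y"
  "\<one>\<^bsub>unit_group\<^esub> = 1"
  by (simp_all add: unit_group_def)

lemma unit_group: "comm_group unit_group"
proof (rule comm_groupI; simp)
  fix x assume x: "x \<in> units"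
  show "\<exists>y\<in>units. y * x = 1"
    using units_cnj[OF x] units_nonzero[OF x] by (intro bexI[of _ "cnj x"]) (simp_all add: units_cnj_eq[OF x])
qed (simp_all add: units_mult units_one algebra_simps)

lemma unit_group_pow: "x [^]\<^bsub>unit_group\<^esub> (n::nat) = x ^ n"
  by (induction n) (simp_all add: mult.commute)

lemma ord_unit_power: "u \<in> units \<Longrightarrow> ord (u ^ n) = int n * ord u"
proof (induction n)
  case (Suc n)
  have "u ^ n \<in> K" "u ^ n \<noteq> 0" for n
    using Suc.prems units_K units_nonzero by (induction n) (auto intro: K_mult R_subset_K)
  then show ?case using Suc ord_mult[of u "u ^ n"] units_K units_nonzero by (simp add: algebra_simps)
qed (simp add: ord_one)

text \<open>
  The trace is an integer between \<open>- 2\<close> and \<open>2\<close>, so \<open>u\<close> is a root of unity of order dividing \<open>4\<close> or \<open>6\<close>.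
\<close>

lemma units_integral_torsion:
  assumes "u \<in> units" "u \<in> R" "cnj u \<in> R"
  shows "u ^ 12 = 1"
proof -
  obtain m n where mn: "u = of_int m + of_int n * \<theta>"
    using in_p_order_integral assms by (auto simp: units_def)
  define t where "t = 2 * m - n * b"
  have cu: "cnj u = of_int t - u" by (simp add: t_def mn cnj_theta algebra_simps)
  have eq: "u * u = of_int t * u - 1"
    using assms(1) by (simp add: units_def cu algebra_simps)
  have "real_of_int t = 2 * Re u" using arg_cong[OF cu, of Re] by simp
  moreover have "\<bar>Re u\<bar> \<le> 1" using abs_Re_le_cmod[of u] units_norm[OF assms(1)] by simp
  ultimately have "t \<in> {- 2..2}" by auto
  then have "t = - 2 \<or> t = - 1 \<or> t = 0 \<or> t = 1 \<or> t = 2" by auto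
  then consider "t = - 2" | "t = - 1" | "t = 0" | "t = 1" | "t = 2" by blast
  then show ?thesis
  proof cases
    case 1
    have "(u + 1) * (u + 1) = u * u + 2 * u + 1" by (simp add: algebra_simps)
    then have "(u + 1) * (u + 1) = 0" unfolding eq using 1 by simp
    then have "u = - 1" by (simp add: eq_neg_iff_add_eq_0)
    then show ?thesis by simp
  next
    case 2
    have "u * (u * u) = u * (of_int t * u - 1)" by (simp only: eq)
    also have "\<dots> = - (u * u) - u" using 2 by (simp add: algebra_simps)
    also have "\<dots> = 1" unfolding eq using 2 by simp
    finally have "u * (u * u) = 1" .
    then have "u ^ 3 = 1" by (simp add: power3_eq_cube mult.assoc)
    then show ?thesis using power_mult[of u 3 4] by simp
  next
    case 3
    then have "u ^ 2 = - 1" using eq by (simp add: power2_eq_square)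
    then show ?thesis using power_mult[of u 2 6] by simp
  next
    case 4
    have "u * (u * u) = u * (of_int t * u - 1)" by (simp only: eq)
    also have "\<dots> = u * u - u" using 4 by (simp add: algebra_simps)
    also have "\<dots> = - 1" unfolding eq using 4 by simp
    finally have "u * (u * u) = - 1" .
    then have "u ^ 3 = - 1" by (simp add: power3_eq_cube mult.assoc)
    then show ?thesis using power_mult[of u 3 4] by simp
  next
    case 5
    then have "(u - 1) * (u - 1) = 0" using eq by (simp add: algebra_simps)
    then have "u = 1" by simp
    then show ?thesis by simp
  qed
qed

lemma ord_zero_iff_torsion:
  assumes u: "u \<in> units"
  shows "ord u = 0 \<longleftrightarrow> u \<in> torsion unit_group"
proof
  assume 0: "ord u = 0"
  have "u \<in> R" "cnj u \<in> R"
    using ord_R[OF units_K[OF u] units_nonzero[OF u]] by (simp_all add: 0 units_cnj_eq[OF u])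
  then have "u ^ 12 = 1" using units_integral_torsion[OF u] by blast
  then show "u \<in> torsion unit_group"
    using u unit_group_pow by (auto simp: torsion_def intro!: exI[of _ 12])
next
  assume "u \<in> torsion unit_group"
  then obtain n :: nat where "n > 0" "u ^ n = 1" using unit_group_pow by (auto simp: torsion_def)
  then show "ord u = 0" using ord_unit_power[OF u, of n] by (simp add: ord_one)
qed

text \<open>
  A unit of positive order smaller than \<open>n\<close> would give an earlier return to \<open>\<theta>\<close>.
\<close>

theorem period_generates:
  assumes "n > 0" "\<xi> n = \<theta>" "\<And>m. 0 < m \<Longrightarrow> m < n \<Longrightarrow> \<xi> m \<noteq> \<theta>"
  shows "generates_mod_torsion unit_group (\<beta> n)"
proof (rule generates_mod_torsionI[where f = ord])
  show "comm_group unit_group" by (rule unit_group)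
  show "ord \<in> hom unit_group integer_group"
    by (rule homI) (simp_all add: ord_mult units_K units_nonzero)
  show "ord u = 0 \<longleftrightarrow> u \<in> torsion unit_group" if "u \<in> carrier unit_group" for u
    using that ord_zero_iff_torsion by simp
  show "\<beta> n \<in> carrier unit_group" "ord (\<beta> n) > 0"
    using return_gives_unit[OF assms(2)] assms(1) by simp_all
  show "ord (\<beta> n) \<le> ord u" if "u \<in> carrier unit_group" "ord u > 0" for u
  proof (rule ccontr)
    assume "\<not> ord (\<beta> n) \<le> ord u"
    then have less: "nat (ord u) < n" using return_gives_unit[OF assms(2)] that(2) by linarith
    have u: "u \<in> units" using that by simp
    have "P powi ord u = P ^ nat (ord u)" using that(2) by (simp add: power_int_def)
    then have "u / P ^ nat (ord u) \<in> R" "cnj u * P ^ nat (ord u) \<in> R"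
      using ord_R[OF units_K[OF u] units_nonzero[OF u]] by (simp_all add: units_cnj_eq[OF u])
    then have "\<xi> (nat (ord u)) = \<theta>" using that(2) by (intro unit_gives_return[OF u]) auto
    then show False using assms(3)[of "nat (ord u)"] less that(2) by simp
  qed
qed

end

section \<open>Integers of an imaginary quadratic field\<close>

text \<open>
  Gauss's lemma: \<open>x\<close> is not real, so the quadratic polynomial \<open>G\<close> divides a monic integral polynomial over
  the rationals.  Pseudo-division turns this into \<open>A\<^sup>k f = G q\<close>, and comparing contents with leading
  coefficients shows that \<open>A\<close> is the content of \<open>G\<close> up to sign.
\<close>

lemma algebraic_int_quadratic_dvd:
  fixes x :: complex and A B C :: int
  assumes "algebraic_int x" "x \<notin> \<real>" and root: "of_int A * x ^ 2 + of_int B * x + of_int C = 0"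
    and "A \<noteq> 0"
  shows "A dvd B" "A dvd C"
proof -
  obtain f :: "int poly" where f: "poly (map_poly of_int f) x = 0" "Polynomial.lead_coeff f = 1"
    using assms(1) by (auto simp: algebraic_int_altdef_ipoly)
  define G where "G = [:C, B, A:]"
  have G: "G \<noteq> 0" "Polynomial.lead_coeff G = A" "Polynomial.degree G = 2" using assms(4) by (simp_all add: G_def)
  obtain q r where qr: "pseudo_divmod f G = (q, r)" by fastforce
  define k where "k = Suc (Polynomial.degree f) - Polynomial.degree G"
  have eq: "Polynomial.smult (A ^ k) f = G * q + r" and r: "r = 0 \<or> Polynomial.degree r < 2"
    using pseudo_divmod[OF G(1) qr] G by (simp_all add: k_def)
  have "poly (map_poly of_int (Polynomial.smult (A ^ k) f)) x = 0"
    using f(1) by (simp add: of_int_hom.map_poly_hom_smult)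
  moreover have "poly (map_poly of_int G) x = 0"
    using root by (simp add: G_def of_int_hom.map_poly_pCons_hom power2_eq_square algebra_simps)
  ultimately have r0: "poly (map_poly of_int r) x = 0"
    unfolding eq by (simp add: hom_distribs)
  have "r = 0"
  proof -
    \<comment> \<open>A real linear equation has no root that is not real.\<close>
    obtain r0 r1 where rr: "r = [:r0, r1:]" using r
      by (metis degree_eq_zeroE less_2_cases_iff pCons_0_0 degree_pCons_eq_if pCons_cases nat.inject numeral_2_eq_2 One_nat_def)
    have eq0: "of_int r0 + of_int r1 * x = 0" using r0
      by (simp add: rr of_int_hom.map_poly_pCons_hom mult.commute)
    have "r1 = 0"
    proof (rule ccontr)
      assume "r1 \<noteq> 0"
      then have "x = of_real (- real_of_int r0 / real_of_int r1)"
        using eq0 by (simp add: field_simps add_eq_0_iff)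
      then show False using assms(2) by (metis Reals_of_real)
    qed
    then show "r = 0" using eq0 rr by simp
  qed
  then have eq: "Polynomial.smult (A ^ k) f = G * q" using eq by simp
  have "content f dvd Polynomial.lead_coeff f" by (rule content_dvd_coeff)
  then have "content f = 1" using f(2) by (metis is_unit_normalize normalize_content)
  then have cont: "\<bar>A ^ k\<bar> = content G * content q"
    using arg_cong[OF eq, of content] by (simp add: content_mult)
  obtain G' q' where G': "G = Polynomial.smult (content G) G'" "q = Polynomial.smult (content q) q'"
    by (metis content_times_primitive_part)
  have lc: "Polynomial.lead_coeff G = content G * Polynomial.lead_coeff G'"
    "Polynomial.lead_coeff q = content q * Polynomial.lead_coeff q'"
    using G' lead_coeff_smult by metis+
  have "A ^ k = Polynomial.lead_coeff G * Polynomial.lead_coeff q"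
    using arg_cong[OF eq, of Polynomial.lead_coeff] f(2) assms(4) by (simp add: lead_coeff_mult)
  also have "\<dots> = (content G * content q) * (Polynomial.lead_coeff G' * Polynomial.lead_coeff q')"
    unfolding lc by (simp only: mult_ac)
  finally have "A ^ k = \<bar>A ^ k\<bar> * (Polynomial.lead_coeff G' * Polynomial.lead_coeff q')"
    unfolding cont .
  then have "\<bar>A ^ k\<bar> * 1 = \<bar>A ^ k\<bar> * \<bar>Polynomial.lead_coeff G' * Polynomial.lead_coeff q'\<bar>"
    by (metis abs_abs abs_mult mult.right_neutral)
  then have "\<bar>Polynomial.lead_coeff G' * Polynomial.lead_coeff q'\<bar> = 1"
    using assms(4) by (subst (asm) mult_cancel_left) simp
  then have "\<bar>Polynomial.lead_coeff G'\<bar> = 1" by (rule abs_zmult_eq_1)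
  then have "A dvd content G"
    using lc(1) G(2) by (metis abs_dvd_iff abs_mult dvd_abs_iff dvd_refl mult.right_neutral)
  then show "A dvd B" "A dvd C"
    using content_dvd_coeff[of G 1] content_dvd_coeff[of G 0] dvd_trans by (auto simp: G_def)
qed

text \<open>
  The square of the denominator of \<open>w\<close> would divide \<open>d\<close>.
\<close>

lemma squarefree_mult_square_int:
  fixes d :: nat and w :: rat
  assumes "squarefree d" "of_nat d * w ^ 2 \<in> \<int>"
  shows "w \<in> \<int>"
proof -
  obtain u v where uv: "w = of_int u / of_int v" "v > 0" "coprime u v"
    by (cases w) (auto simp: Fract_of_int_quotient)
  obtain m where m: "of_nat d * w ^ 2 = of_int m" using assms(2) by (rule Ints_cases)
  have "of_int (int d * u ^ 2) = (of_int (m * v ^ 2) :: rat)"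
    using m uv(1,2) by (simp add: field_simps power_divide)
  then have "int d * u ^ 2 = m * v ^ 2" by (simp only: of_int_eq_iff)
  then have "v ^ 2 dvd int d * u ^ 2" by simp
  moreover have "coprime (v ^ 2) (u ^ 2)" using uv(3) by (simp add: coprime_commute)
  ultimately have "v ^ 2 dvd int d" by (simp add: coprime_dvd_mult_left_iff)
  then have "nat v ^ 2 dvd d" using uv(2) by (metis int_dvd_int_iff int_nat_eq less_imp_le of_nat_power)
  then have "nat v dvd 1" using assms(1) squarefreeD by blast
  then have "v = 1" using uv(2) by simp
  then show ?thesis using uv(1) by simp
qed

text \<open>
  The minimal polynomial of \<open>cf_theta d\<close> is \<open>X\<^sup>2 + theta_b d X + theta_c d\<close>.
\<close>

definition theta_b :: "nat \<Rightarrow> int" where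
  "theta_b d = (if [- int d = 1] (mod 4) then 1 else 0)"

definition theta_c :: "nat \<Rightarrow> int" where
  "theta_c d = (if [- int d = 1] (mod 4) then (1 + int d) div 4 else int d)"

lemma sqrt_neg_square: "sqrt_neg d * sqrt_neg d = - of_nat d"
  by (simp add: sqrt_neg_def complex_eq_iff)

lemma cong_minus_one_iff: "[- int d = 1] (mod 4) \<longleftrightarrow> d mod 4 = 3"
proof -
  have "[- int d = 1] (mod 4) \<longleftrightarrow> int d mod 4 = 3" unfolding cong_def by presburger
  also have "\<dots> \<longleftrightarrow> int (d mod 4) = int 3" by (simp add: zmod_int)
  also have "\<dots> \<longleftrightarrow> d mod 4 = 3" by (simp only: of_nat_eq_iff)
  finally show ?thesis .
qed

lemma cf_theta_eq: "cf_theta d ^ 2 + of_int (theta_b d) * cf_theta d + of_int (theta_c d) = 0"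
proof (cases "d mod 4 = 3")
  case True
  then obtain e where d: "d = 4 * e + 3" by (metis mult_div_mod_eq)
  have "(of_nat d :: complex) = 4 * of_nat e + 3" by (simp add: d)
  then have s: "sqrt_neg d * sqrt_neg d = - 4 * of_nat e - 3" by (simp add: sqrt_neg_square)
  have c: "theta_c d = int e + 1" using True by (simp add: theta_c_def cong_minus_one_iff) (simp add: d)
  have "((- 1 + sqrt_neg d) / 2) ^ 2 + (- 1 + sqrt_neg d) / 2 + of_int (theta_c d)
      = (sqrt_neg d * sqrt_neg d - 1) / 4 + of_nat e + 1"
    by (simp add: c power2_eq_square field_simps)
  then show ?thesis
    using True unfolding s by (simp add: cf_theta_def theta_b_def cong_minus_one_iff field_simps)
next
  case False
  then show ?thesis
    by (simp add: cf_theta_def theta_b_def theta_c_def cong_minus_one_iff power2_eq_square sqrt_neg_square)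
qed

lemma cf_theta_sqrt_neg:
  "cf_theta d = of_rat (- of_int (theta_b d) / 2) + of_rat (if d mod 4 = 3 then 1 / 2 else 1) * sqrt_neg d"
  by (simp add: cf_theta_def theta_b_def cong_minus_one_iff of_rat_divide of_rat_minus field_simps)

lemma sqrt_neg_cf_theta:
  "sqrt_neg d = of_int (theta_b d) + (if d mod 4 = 3 then 2 else 1) * cf_theta d"
  by (simp add: cf_theta_def theta_b_def cong_minus_one_iff)

lemma cf_theta_in_field: "cf_theta d \<in> imag_quad_field d"
  unfolding imag_quad_field_def using cf_theta_sqrt_neg by blast

lemma imag_quad_field_cnj:
  assumes "x \<in> imag_quad_field d"
  shows "cnj x \<in> imag_quad_field d"
proof -
  obtain a b where "x = of_rat a + of_rat b * sqrt_neg d" using assms by (auto simp: imag_quad_field_def)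
  then have "cnj x = of_rat a + of_rat (- b) * sqrt_neg d" by (simp add: sqrt_neg_def of_rat_minus)
  then show ?thesis unfolding imag_quad_field_def by blast
qed

lemma cf_theta_diff_cnj: "cf_theta d - cnj (cf_theta d) = (if d mod 4 = 3 then 1 else 2) * sqrt_neg d"
  by (simp add: cf_theta_def cong_minus_one_iff sqrt_neg_def field_simps)

lemma cf_theta_fund_dom:
  assumes "d > 0"
  shows "cf_theta d \<in> fund_dom"
proof -
  define z where "z = cf_theta d"
  have d1: "1 \<le> sqrt (real d)" using assms by simp
  have *: "Im z > 0 \<and> - 1 / 2 \<le> Re z \<and> Re z \<le> 0 \<and> 1 \<le> cmod z"
  proof (cases "d mod 4 = 3")
    case True
    then have "d \<ge> 3" by presburger
    have z: "z = Complex (- 1 / 2) (sqrt (real d) / 2)"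
      using True by (simp add: z_def cf_theta_def cong_minus_one_iff sqrt_neg_def complex_eq_iff)
    have "(cmod z) ^ 2 = (1 + real d) / 4"
      by (simp add: z cmod_power2 power_divide add_divide_distrib)
    also have "\<dots> \<ge> 1" using \<open>d \<ge> 3\<close> by simp
    finally have "1 ^ 2 \<le> (cmod z) ^ 2" by simp
    then have "1 \<le> cmod z" by (rule power2_le_imp_le) simp
    then show ?thesis using assms by (simp add: z)
  next
    case False
    then have z: "z = \<i> * of_real (sqrt (real d))"
      by (simp add: z_def cf_theta_def cong_minus_one_iff sqrt_neg_def)
    then show ?thesis using d1 assms by (simp add: z norm_mult)
  qed
  show ?thesis
  proof (cases "cmod z = 1")
    case True
    then show ?thesis using fund_dom_arc[of z] * by (simp add: z_def)
  next
    case False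
    then show ?thesis using * by (simp add: fund_dom_def z_def)
  qed
qed

text \<open>
  Twice the rational part and the norm of an algebraic integer are integers; as \<open>d\<close> is squarefree, so is
  twice the coefficient of \<open>sqrt_neg d\<close>.  The equation \<open>A\<^sup>2 + d B\<^sup>2 = 4 n\<close> modulo \<open>4\<close> then decides which
  halves occur.
\<close>

lemma ring_of_integers_cf_theta:
  assumes "squarefree d" "x \<in> ring_of_integers (imag_quad_field d)"
  obtains m n where "x = of_int m + of_int n * cf_theta d"
proof -
  have "d \<noteq> 0" using assms(1) by (metis not_squarefree_0)
  obtain a b where x: "x = of_rat a + of_rat b * sqrt_neg d" and alg: "algebraic_int x"
    using assms(2) by (auto simp: ring_of_integers_def imag_quad_field_def)
  have "2 * a \<in> \<int> \<and> a ^ 2 + of_nat d * b ^ 2 \<in> \<int>"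
  proof (cases "b = 0")
    case True
    have "x \<in> \<int>" using rational_algebraic_int_is_int[OF alg] by (simp add: x True)
    then obtain m where "x = of_int m" by (rule Ints_cases)
    then have "of_rat a = (of_rat (of_int m) :: complex)" by (simp add: x True)
    then have "a = of_int m" by (simp only: of_rat_eq_iff)
    then show ?thesis by (simp add: True)
  next
    case False
    define \<nu> where "\<nu> = a ^ 2 + of_nat d * b ^ 2"
    obtain u v where uv: "2 * a = of_int u / of_int v" "v > 0"
      by (cases "2 * a") (auto simp: Fract_of_int_quotient)
    obtain u' v' where uv': "\<nu> = of_int u' / of_int v'" "v' > 0"
      by (cases \<nu>) (auto simp: Fract_of_int_quotient)
    have "x ^ 2 - of_rat (2 * a) * x + of_rat \<nu> = 0"
    proof -
      have "x ^ 2 - of_rat (2 * a) * x + of_rat \<nu>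
          = of_rat (b * b) * (sqrt_neg d * sqrt_neg d) + of_rat (b * b) * of_nat d"
        by (simp add: x \<nu>_def of_rat_add of_rat_mult power2_eq_square algebra_simps)
      then show ?thesis by (simp add: sqrt_neg_square)
    qed
    moreover have T: "of_int u = of_int v * (of_rat (2 * a) :: complex)"
      and N: "of_int u' = of_int v' * (of_rat \<nu> :: complex)"
      unfolding uv(1) uv'(1) of_rat_divide using uv(2) uv'(2) by simp_all
    have "of_int (v * v') * x ^ 2 + of_int (- (u * v')) * x + of_int (u' * v)
        = of_int v * of_int v' * (x ^ 2 - of_rat (2 * a) * x + of_rat \<nu>)"
      unfolding of_int_mult of_int_minus T N by (simp add: algebra_simps)
    ultimately have root: "of_int (v * v') * x ^ 2 + of_int (- (u * v')) * x + of_int (u' * v) = 0"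
      by simp
    have "Im x = of_rat b * sqrt (real d)"
      by (cases a; cases b) (simp add: x sqrt_neg_def Fract_of_int_quotient of_rat_divide)
    then have "Im x \<noteq> 0" using False \<open>d \<noteq> 0\<close> by simp
    then have "x \<notin> \<real>" by (auto simp: complex_is_Real_iff)
    then have "v * v' dvd - (u * v')" "v * v' dvd u' * v"
      using algebraic_int_quadratic_dvd[OF alg _ root] uv(2) uv'(2) by auto
    then have "v dvd u" "v' dvd u'" using uv(2) uv'(2) by (simp_all add: mult.commute)
    then have "2 * a \<in> \<int>" "\<nu> \<in> \<int>"
      unfolding uv(1) uv'(1) by (auto elim!: dvdE)
    then show ?thesis by (simp add: \<nu>_def)
  qed
  then obtain A n where A: "2 * a = of_int A" and n: "a ^ 2 + of_nat d * b ^ 2 = of_int n"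
    by (auto elim!: Ints_cases)
  have "of_nat d * (2 * b) ^ 2 = 4 * (a ^ 2 + of_nat d * b ^ 2) - (2 * a) ^ 2"
    by (simp add: power2_eq_square algebra_simps)
  also have "\<dots> = of_int (4 * n - A ^ 2)" by (simp only: A n) simp
  finally have d: "of_nat d * (2 * b) ^ 2 = (of_int (4 * n - A ^ 2) :: rat)" .
  then have "2 * b \<in> \<int>" using squarefree_mult_square_int[OF assms(1), of "2 * b"] by simp
  then obtain B where B: "2 * b = of_int B" by (rule Ints_cases)
  have "of_int (int d * B ^ 2) = (of_int (4 * n - A ^ 2) :: rat)" using d by (simp add: B)
  then have AB: "A ^ 2 + int d * B ^ 2 = 4 * n" by (simp only: of_int_eq_iff)
  have ab: "a = of_int A / 2" "b = of_int B / 2" using A B by simp_all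
  show ?thesis
  proof (cases "d mod 4 = 3")
    case True
    then have "odd d" by presburger
    have "even (A ^ 2 + int d * B ^ 2)" unfolding AB by simp
    then have "even (A + B)" using \<open>odd d\<close> by simp
    then obtain k where k: "A + B = 2 * k" by (rule evenE)
    then have "A = 2 * k - B" by simp
    then have A2: "(of_int A :: complex) = 2 * of_int k - of_int B" by simp
    then have "x = of_int k + of_int B * cf_theta d"
      unfolding x ab using True
      by (simp add: cf_theta_def cong_minus_one_iff of_rat_divide A2 field_simps)
    then show ?thesis by (rule that)
  next
    case False
    have "\<not> 4 dvd d"
    proof
      assume "4 dvd d"
      then have "2 ^ 2 dvd d" by simp
      then have "2 dvd (1 :: nat)" using assms(1) squarefreeD by blast
      then show False by simp
    qed
    then have "d mod 4 = 1 \<or> d mod 4 = 2" using False by presburger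
    then have dmod: "int d mod 4 = 1 \<or> int d mod 4 = 2" by presburger
    have sq: "(y :: int) ^ 2 mod 4 = (if even y then 0 else 1)" for y
    proof (cases "even y")
      case True
      then show ?thesis by (auto elim!: evenE simp: power2_eq_square)
    next
      case False
      then obtain k where "y = 2 * k + 1" by (rule oddE)
      then have "y ^ 2 = 1 + (k * k + k) * 4" by (simp add: power2_eq_square algebra_simps)
      then have "y ^ 2 mod 4 = 1 mod 4" by (simp only: mod_mult_self1)
      then show ?thesis using False by simp
    qed
    have "(A ^ 2 mod 4 + (int d mod 4) * (B ^ 2 mod 4)) mod 4 = 0"
    proof -
      have "(A ^ 2 mod 4 + (int d mod 4) * (B ^ 2 mod 4)) mod 4 = (A ^ 2 + int d * B ^ 2) mod 4"
        by (metis mod_add_eq mod_add_left_eq mod_mult_eq)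
      then show ?thesis by (simp add: AB)
    qed
    then have "even A \<and> even B" using dmod unfolding sq by (auto split: if_splits)
    then obtain k l where "A = 2 * k" "B = 2 * l" by (auto elim!: evenE)
    then have "x = of_int k + of_int l * cf_theta d"
      unfolding x ab using False by (simp add: cf_theta_def cong_minus_one_iff)
    then show ?thesis by (rule that)
  qed
qed

lemma cf_theta_ring_of_integers:
  "of_int m + of_int n * cf_theta d \<in> ring_of_integers (imag_quad_field d)"
proof -
  let ?t = "cf_theta d" and ?b = "theta_b d" and ?c = "theta_c d"
  define x where "x = of_int m + of_int n * ?t"
  have "x \<in> imag_quad_field d"
    using imag_quad_field_add[OF imag_quad_field_rat[of "of_int m"]
        imag_quad_field_mult_rat[OF cf_theta_in_field, of "of_int n"]] by (simp add: x_def)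
  moreover have "algebraic_int x"
  proof (rule algebraic_int.intros)
    define p :: "complex poly" where "p = [:of_int (m ^ 2 - ?b * m * n + ?c * n ^ 2), of_int (?b * n - 2 * m), 1:]"
    show "Polynomial.lead_coeff p = 1" by (simp add: p_def)
    show "\<forall>i. Polynomial.coeff p i \<in> \<int>" by (auto simp: p_def coeff_pCons split: nat.splits)
    have "poly p x = of_int n ^ 2 * (?t ^ 2 + of_int ?b * ?t + of_int ?c)"
      by (simp add: p_def x_def power2_eq_square algebra_simps)
    then show "poly p x = 0" by (simp add: cf_theta_eq)
  qed
  ultimately show ?thesis by (simp add: ring_of_integers_def x_def)
qed

context padic_identification
begin

text \<open>
  If \<open>sqrt_neg d\<close> were not a unit, then \<open>p\<^sup>2\<close> would divide its square \<open>- d\<close>.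
\<close>

lemma sqrt_neg_unit:
  assumes "squarefree d" "imag_quad_field d \<subseteq> K"
  shows "sqrt_neg d \<in> R" "1 / sqrt_neg d \<in> R"
proof -
  let ?s = "sqrt_neg d"
  have "d \<noteq> 0" using assms(1) by (metis not_squarefree_0)
  have s0: "?s \<noteq> 0" using \<open>d \<noteq> 0\<close> by (simp add: sqrt_neg_def)
  have sK: "?s \<in> K"
  proof -
    have "?s = of_rat 0 + of_rat 1 * ?s" by simp
    then have "?s \<in> imag_quad_field d" unfolding imag_quad_field_def by blast
    then show ?thesis using assms(2) by blast
  qed
  show "?s \<in> R"
  proof (rule ccontr)
    assume n: "?s \<notin> R"
    have "?s = - of_nat d * (P * (1 / (P * ?s)))"
      using s0 sqrt_neg_square[of d] by (simp add: field_simps)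
    also have "\<dots> \<in> R" using R_valuation_ring[OF sK n] by (intro R_mult R_uminus R_of_nat R_P)
    finally show False using n by simp
  qed
  show "1 / ?s \<in> R"
  proof (rule ccontr)
    assume n: "1 / ?s \<notin> R"
    have "1 / ?s \<in> K" using K_divide[OF _ sK, of 1] K_of_int[of 1] by simp
    then have "1 / (P * (1 / ?s)) \<in> R" using n by (rule R_valuation_ring)
    then have "?s / P \<in> R" by simp
    then have "?s / P * (?s / P) \<in> R" by (intro R_mult)
    then have "of_int (- int d) / P ^ 2 \<in> R" using sqrt_neg_square[of d] by (simp add: power2_eq_square)
    then have "int CARD('p) ^ 2 dvd - int d" by (rule R_int_dvd)
    then have "int (CARD('p) ^ 2) dvd int d" by simp
    then have "CARD('p) ^ 2 dvd d" by (simp only: int_dvd_int_iff)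
    then have "CARD('p) dvd 1" using assms(1) squarefreeD by blast
    then show False using prime_gt_1_nat[OF prime_card[where 'a = 'p]] by simp
  qed
qed

text \<open>
  The case \<open>p = 2\<close> matters when \<open>\<theta> = sqrt_neg d\<close>, where the different is \<open>2 sqrt_neg d\<close>.  There \<open>- d\<close> is the
  square of a 2-adic unit, hence congruent to \<open>1\<close> modulo \<open>4\<close>, which excludes this choice of \<open>\<theta>\<close>.
\<close>

lemma cf_theta_different_unit:
  assumes "squarefree d" "imag_quad_field d \<subseteq> K"
  shows "1 / (cf_theta d - cnj (cf_theta d)) \<in> R"
proof (cases "d mod 4 = 3")
  case True
  then show ?thesis using sqrt_neg_unit[OF assms] by (simp add: cf_theta_diff_cnj)
next
  case False
  let ?s = "sqrt_neg d"
  have "d \<noteq> 0" using assms(1) by (metis not_squarefree_0)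
  then have s0: "?s \<noteq> 0" by (simp add: sqrt_neg_def)
  have "1 / 2 \<in> R"
  proof (rule ccontr)
    assume n: "1 / 2 \<notin> R"
    have half: "x \<notin> R" if "x * y = 1 / 2" "y \<in> R" for x y using n that R_mult[of x y] by metis
    have "1 / 2 \<in> K" using K_divide[of 1 2] K_of_int[of 1] K_of_int[of 2] by simp
    then have "1 / (P * (1 / 2)) \<in> R" using n by (rule R_valuation_ring)
    then have "of_int 2 / P ^ 1 \<in> R" by simp
    then have "int CARD('p) ^ 1 dvd 2" by (rule R_int_dvd)
    then have "int CARD('p) dvd int 2" by simp
    then have "CARD('p) dvd 2" by (simp only: int_dvd_int_iff)
    then have p2: "CARD('p) = 2"
      using prime_card[where 'a = 'p] two_is_prime_nat by (metis primes_dvd_imp_eq)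
    then have P2: "P = 2" by (simp add: P_def)
    obtain a where a: "a < 2" "(?s - of_nat a) / 2 \<in> R"
      using R_residue[OF sqrt_neg_unit(1)[OF assms], of 1] by (auto simp: p2 P2)
    have "?s / 2 \<notin> R" using half[of "?s / 2" "1 / ?s"] sqrt_neg_unit(2)[OF assms] s0 by simp
    then have "a \<noteq> 0" using a(2) by (metis diff_zero of_nat_0)
    then have "a = 1" using a(1) by simp
    define t where "t = (?s - 1) / 2"
    have t: "t \<in> R" using a(2) by (simp add: t_def \<open>a = 1\<close>)
    have "?s = 1 + 2 * t" by (simp add: t_def)
    then have "- of_nat d = (1 + 2 * t) * (1 + 2 * t)" using sqrt_neg_square[of d] by metis
    then have "of_int (- int d - 1) / P ^ 2 = t + t * t"
      by (simp add: P2 field_simps)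
    then have "int CARD('p) ^ 2 dvd - int d - 1"
      using t by (intro R_int_dvd) (simp add: R_add R_mult)
    then have "4 dvd - int d - 1" by (simp add: p2)
    then have "d mod 4 = 3" by presburger
    then show False using False by simp
  qed
  then have "1 / 2 * (1 / ?s) \<in> R" using sqrt_neg_unit(2)[OF assms] by (rule R_mult)
  then show ?thesis using False by (simp add: cf_theta_diff_cnj)
qed

lemma quadratic_generator_cf_theta:
  assumes "squarefree d" "imag_quad_field d \<subseteq> K" "cf_defined \<iota> (cf_theta d)"
  shows "quadratic_generator \<iota> P (cf_theta d) (theta_b d) (theta_c d)"
proof unfold_locales
  have "d \<noteq> 0" using assms(1) by (metis not_squarefree_0)
  then have "d > 0" by simp
  then show "cf_theta d \<in> fund_dom" by (rule cf_theta_fund_dom)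
  show "cf_theta d \<in> K" "cnj (cf_theta d) \<in> K"
    using assms(2) cf_theta_in_field imag_quad_field_cnj by blast+
qed (use cf_theta_eq cf_theta_different_unit assms in auto)

end

context quadratic_generator
begin

lemma norm_one_p_units_eq:
  assumes "squarefree d" "\<theta> = cf_theta d"
  shows "norm_one_p_units CARD('p) (imag_quad_field d) = unit_group"
proof -
  have int: "p_integers CARD('p) (imag_quad_field d) = {u. in_p_order u}"
  proof (intro equalityI subsetI)
    fix u assume "u \<in> p_integers CARD('p) (imag_quad_field d)"
    then obtain x k where u: "u = x / of_nat CARD('p) ^ k" "x \<in> ring_of_integers (imag_quad_field d)"
      by (auto simp: p_integers_def)
    obtain m n where "x = of_int m + of_int n * \<theta>"
      using ring_of_integers_cf_theta[OF assms(1) u(2)] assms(2) by metis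
    then have "u = of_rat (of_int m / of_nat CARD('p) ^ k) + of_rat (of_int n / of_nat CARD('p) ^ k) * \<theta>"
      by (simp add: u(1) of_rat_divide of_rat_power add_divide_distrib)
    then show "u \<in> {u. in_p_order u}" using in_p_orderI p_fractionsI by blast
  next
    fix u assume "u \<in> {u. in_p_order u}"
    then obtain x y where xy: "x \<in> p_fractions CARD('p)" "y \<in> p_fractions CARD('p)"
        "u = of_rat x + of_rat y * \<theta>" by (auto elim: in_p_orderE)
    obtain m k where x: "x = of_int m / of_nat CARD('p) ^ k" using xy(1) by (auto simp: p_fractions_def)
    obtain n l where y: "y = of_int n / of_nat CARD('p) ^ l" using xy(2) by (auto simp: p_fractions_def)
    have "u = of_int m / P ^ k + of_int n / P ^ l * \<theta>"
      by (simp add: xy(3) x y P_def of_rat_divide of_rat_power)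
    also have "\<dots> = (of_int (m * int CARD('p) ^ l) + of_int (n * int CARD('p) ^ k) * \<theta>) / P ^ (k + l)"
      by (simp add: P_def power_add add_divide_distrib)
    finally show "u \<in> p_integers CARD('p) (imag_quad_field d)"
      unfolding p_integers_def P_def using cf_theta_ring_of_integers assms(2) by blast
  qed
  have "{x \<in> {u. in_p_order u}. (\<exists>y \<in> {u. in_p_order u}. x * y = 1) \<and> x * cnj x = 1} = units"
    using in_p_order_cnj by (auto simp: units_def)
  then show ?thesis by (simp add: norm_one_p_units_def unit_group_def int)
qed

end

section \<open>The two parts of the theorem\<close>

lemma imag_quadratic_quad_root:
  assumes "imag_quadratic z" "Im z > 0"
  obtains D where "D < 0" "quad_root D z"
proof -
  obtain a b c :: int where *: "a \<noteq> 0" "of_int a * z ^ 2 + of_int b * z + of_int c = 0"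
    using assms(1) by (auto simp: imag_quadratic_def)
  define w where "w = 2 * of_int a * z + of_int b"
  define D where "D = b ^ 2 - 4 * a * c"
  \<comment> \<open>Completing the square: a negative discriminant is the square of a purely imaginary number.\<close>
  have "w * w = 4 * of_int a * (of_int a * z ^ 2 + of_int b * z + of_int c) + of_int D"
    by (simp add: w_def D_def power2_eq_square algebra_simps)
  then have ww: "w * w = of_int D" by (simp add: *(2))
  have "Im w = 2 * real_of_int a * Im z" by (simp add: w_def)
  then have im: "Im w \<noteq> 0" using assms(2) *(1) by simp
  moreover have "Im w * Re w = 0" using arg_cong[OF ww, of Im] by simp
  ultimately have "real_of_int D = - (Im w * Im w)" using arg_cong[OF ww, of Re] by simp
  moreover have "Im w * Im w > 0" using im by (simp add: zero_less_mult_iff) linarith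
  ultimately have "D < 0" by linarith
  then show ?thesis using that[of D] *(2) by (auto simp: D_def quad_root_def)
qed

text \<open>
  Otherwise \<open>d = 3 q\<^sup>2\<close> for a rational number \<open>q\<close>, which is an integer because \<open>3\<close> is squarefree, and
  which is \<open>\<plusminus>1\<close> because \<open>d\<close> is.
\<close>

lemma cf_theta_notin_field_3:
  assumes "squarefree d" "d \<noteq> 3"
  shows "cf_theta d \<notin> imag_quad_field 3"
proof
  assume "cf_theta d \<in> imag_quad_field 3"
  then have "of_rat (of_int (theta_b d)) + of_rat (if d mod 4 = 3 then 2 else 1) * cf_theta d \<in> imag_quad_field 3"
    by (intro imag_quad_field_add imag_quad_field_rat imag_quad_field_mult_rat)
  then have "sqrt_neg d \<in> imag_quad_field 3"
    unfolding sqrt_neg_cf_theta by (auto split: if_splits)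
  then obtain r q where rq: "sqrt_neg d = of_rat r + of_rat q * sqrt_neg 3" by (auto simp: imag_quad_field_def)
  have rat: "of_rat y = complex_of_real (real_of_rat y)" for y
    by (cases y) (simp add: Fract_of_int_quotient of_rat_divide)
  have "sqrt (real d) = real_of_rat q * sqrt 3"
    using arg_cong[OF rq[unfolded rat], of Im] by (simp add: sqrt_neg_def)
  then have "(sqrt (real d)) ^ 2 = (real_of_rat q * sqrt 3) ^ 2" by simp
  then have "real d = 3 * (real_of_rat q) ^ 2" by (simp add: power_mult_distrib)
  then have "real_of_rat (of_nat d) = real_of_rat (3 * q ^ 2)" by (simp add: of_rat_mult of_rat_power)
  then have dq: "of_nat d = 3 * q ^ 2" by (simp only: of_rat_eq_iff)
  have "squarefree (3 :: nat)" by (rule squarefree_prime) simp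
  then have "q \<in> \<int>" using squarefree_mult_square_int[of 3 q] dq by (metis Ints_of_nat of_nat_numeral)
  then obtain m where m: "q = of_int m" by (rule Ints_cases)
  have "of_int (int d) = (of_int (3 * m ^ 2) :: rat)" using dq by (simp add: m)
  then have d: "int d = 3 * m ^ 2" by (simp only: of_int_eq_iff)
  then have "int (nat \<bar>m\<bar> ^ 2) dvd int d" by simp
  then have "nat \<bar>m\<bar> ^ 2 dvd d" by (simp only: int_dvd_int_iff)
  then have "nat \<bar>m\<bar> = 1" using squarefreeD[OF assms(1)] by simp
  then have "\<bar>m\<bar> = 1" by simp
  then have "m ^ 2 = 1" by (metis one_power2 power2_abs)
  then have "int d = 3" using d by simp
  then show False using assms(2) by simp
qed

theorem theorem5:
  fixes \<iota> :: "complex \<Rightarrow> 'p::prime_card padic alg_closure"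
  assumes "field_isom \<iota>"
  shows
    "(\<forall>z. Im z > 0 \<and> z \<in> padic_numbers \<iota> \<and> imag_quadratic z \<and>
          (z \<in> imag_quad_field 3 \<longrightarrow> cf_defined \<iota> z)
        \<longrightarrow> (\<exists>k l. 1 \<le> k \<and> k < l \<and> cf_x \<iota> z k = cf_x \<iota> z l)) \<and>
     (\<forall>(d::nat) \<theta>.
          d > 0 \<and> squarefree d \<and> imag_quad_field d \<subseteq> padic_numbers \<iota> \<and> \<theta> = cf_theta d \<and>
          (d = 3 \<longrightarrow> cf_defined \<iota> \<theta>)
        \<longrightarrow> (\<exists>N\<ge>1. \<theta> = cf_x \<iota> \<theta> 1 \<and> cf_x \<iota> \<theta> 1 = cf_x \<iota> \<theta> (N + 1)) \<and>
            (\<forall>N. N \<ge> 1 \<and> cf_x \<iota> \<theta> (N + 1) = \<theta> \<and>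
                 (\<forall>M. 1 \<le> M \<and> M < N \<longrightarrow> cf_x \<iota> \<theta> (M + 1) \<noteq> \<theta>)
               \<longrightarrow> (let C = matrix_inv (cf_B \<iota> \<theta> N);
                        \<epsilon> = of_rat (C $ 2 $ 1) * \<theta> + of_rat (C $ 2 $ 2)
                    in generates_mod_torsion
                         (norm_one_p_units CARD('p) (imag_quad_field d)) \<epsilon>)))"
  (is "?part1 \<and> ?part2")
proof
  interpret padic_identification \<iota> "of_nat CARD('p)"
    by (rule padic_identification.intro) (simp_all add: assms)
  show ?part1
  proof (intro allI impI, elim conjE)
    fix z assume z: "Im z > 0" "z \<in> K" "imag_quadratic z" "z \<in> imag_quad_field 3 \<longrightarrow> cf_defined \<iota> z"
    obtain D where D: "D < 0" "quad_root D z" using imag_quadratic_quad_root z by blast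
    have "cf_defined \<iota> z" using z cf_defined_generic by blast
    then obtain m n where "m < n" "(cf_next \<iota> ^^ m) z = (cf_next \<iota> ^^ n) z"
      using cf_iterate_repeats[of D z] D z by (auto simp: complete_quotient_def)
    then show "\<exists>k l. 1 \<le> k \<and> k < l \<and> cf_x \<iota> z k = cf_x \<iota> z l"
      by (intro exI[of _ "Suc m"] exI[of _ "Suc n"]) (simp add: cf_x_def)
  qed
  show ?part2
  proof (intro allI impI, elim conjE)
    fix d :: nat and \<theta>
    assume d: "d > 0" "squarefree d" "imag_quad_field d \<subseteq> K"
      and th: "\<theta> = cf_theta d" and def3: "d = 3 \<longrightarrow> cf_defined \<iota> \<theta>"
    have "cf_defined \<iota> \<theta>"
    proof (cases "d = 3")
      case False
      show ?thesis
        using cf_defined_generic cf_theta_notin_field_3[OF d(2) False]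
          fund_dom_bounds(1)[OF cf_theta_fund_dom[OF d(1)]] by (simp add: th)
    qed (use def3 in simp)
    then interpret quadratic_generator \<iota> "of_nat CARD('p)" \<theta> "theta_b d" "theta_c d"
      unfolding th by (intro quadratic_generator_cf_theta d)
    have x: "cf_x \<iota> \<theta> (n + 1) = (cf_next \<iota> ^^ n) \<theta>" for n by (simp add: cf_x_def)
    show "(\<exists>N\<ge>1. \<theta> = cf_x \<iota> \<theta> 1 \<and> cf_x \<iota> \<theta> 1 = cf_x \<iota> \<theta> (N + 1)) \<and>
            (\<forall>N. N \<ge> 1 \<and> cf_x \<iota> \<theta> (N + 1) = \<theta> \<and>
                 (\<forall>M. 1 \<le> M \<and> M < N \<longrightarrow> cf_x \<iota> \<theta> (M + 1) \<noteq> \<theta>)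
               \<longrightarrow> (let C = matrix_inv (cf_B \<iota> \<theta> N);
                        \<epsilon> = of_rat (C $ 2 $ 1) * \<theta> + of_rat (C $ 2 $ 2)
                    in generates_mod_torsion
                         (norm_one_p_units CARD('p) (imag_quad_field d)) \<epsilon>))"
    proof (intro conjI allI impI)
      obtain n where "n > 0" "(cf_next \<iota> ^^ n) \<theta> = \<theta>" by (rule exists_return)
      then show "\<exists>N\<ge>1. \<theta> = cf_x \<iota> \<theta> 1 \<and> cf_x \<iota> \<theta> 1 = cf_x \<iota> \<theta> (N + 1)"
        by (intro exI[of _ n]) (simp add: cf_x_def)
    next
      fix N assume "N \<ge> 1 \<and> cf_x \<iota> \<theta> (N + 1) = \<theta> \<and>
        (\<forall>M. 1 \<le> M \<and> M < N \<longrightarrow> cf_x \<iota> \<theta> (M + 1) \<noteq> \<theta>)"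
      then have "generates_mod_torsion unit_group (\<beta> N)"
        unfolding x by (intro period_generates) auto
      then show "let C = matrix_inv (cf_B \<iota> \<theta> N);
                     \<epsilon> = of_rat (C $ 2 $ 1) * \<theta> + of_rat (C $ 2 $ 2)
                 in generates_mod_torsion (norm_one_p_units CARD('p) (imag_quad_field d)) \<epsilon>"
        by (simp add: matrix_inv_cf_B norm_one_p_units_eq[OF d(2) th] \<beta>_def row2_def)
    qed
  qed
qed

end
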